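(* Let $(\Sigma^+,\sigma)$ be a transitive one-sided countable Markov shift of finite topological entropy and let $\phi:\Sigma^+\to\mathbb{R}$ be a bounded function of summable variations. Let $(\mu_n)_n$ be a sequence of ergodic $\sigma$-invariant probability measures such that $$\lim_{n\to\infty}\left(h_{\mu_n}(\sigma)+\int\phi\,d\mu_n\right)=P(\phi).$$ If $(\mu_n)_n$ converges in the weak$^*$ topology to an ergodic measure $\mu$, then $$P(\phi)=h_\mu(\sigma)+\int\phi\,d\mu.$$
   Context: One-sided countable Markov shift: let $\mathcal{A}$ be a countable alphabet and $S=(s_{ij})_{\mathcal{A}\times\mathcal{A}}$ a matrix of zeros and ones. Set $\Sigma^+=\{x\in\mathcal{A}^{\mathbb{N}}: s_{x_ix_{i+1}}=1\text{ for every } i\in\mathbb{N}\}$, $(\sigma(x))_i=x_{i+1}$, with the topology generated by cylinder sets. Transitive means that for all $a,b\in\mathcal{A}$ there is an admissible word (all consecutive transitions allowed by $S$) starting at $a$ and ending at $b$. $\mathcal{M}_\sigma$ and $\mathcal{E}_\sigma$ are the sets of invariant, respectively ergodic invariant, Borel probability measures, and $h_\mu(\sigma)$ is the measure-theoretic entropy. The topological entropy is $h_{top}(\sigma)=\sup\{h_\mu(\sigma):\mu\in\mathcal{E}_\sigma\}$. Summable variations: $\sum_{n=1}^\infty \mathrm{var}_n(\phi)<\infty$, where $\mathrm{var}_n(\phi)=\sup\{\phi(x)-\phi(y): x_i=y_i,\ i\in\{1,\dots,n\}\}$ (coordinates indexed from $1$). $P(\phi)$ is the Gurevich pressure of $\phi$,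 which satisfies the variational principle $$P(\phi)=\sup\Big\{h_\mu(\sigma)+\int\phi\,d\mu:\mu\in\mathcal{M}_\sigma\Big\}=\sup\Big\{h_\mu(\sigma)+\int\phi\,d\mu:\mu\in\mathcal{E}_\sigma\Big\};$$ this may be taken as its definition. Weak$^*$ convergence is convergence of integrals of all bounded continuous functions. *)

theory Defs
  imports "HOL-Probability.Probability"
begin

section \<open>One-sided countable Markov shifts\<close>

text \<open>The alphabet is a type of class \<open>countable\<close> and the 0-1 matrix is a Boolean matrix.
  Coordinates of sequences are numbered from 0.\<close>

definition markov_shift :: "('a \<Rightarrow> 'a \<Rightarrow> bool) \<Rightarrow> (nat \<Rightarrow> 'a) set" where
  "markov_shift S = {x. \<forall>i. S (x i) (x (Suc i))}"

definition left_shift :: "(nat \<Rightarrow> 'a) \<Rightarrow> (nat \<Rightarrow> 'a)" where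
  "left_shift x = (\<lambda>i. x (Suc i))"

definition cylinder :: "('a \<Rightarrow> 'a \<Rightarrow> bool) \<Rightarrow> 'a list \<Rightarrow> (nat \<Rightarrow> 'a) set" where
  "cylinder S w = {x \<in> markov_shift S. \<forall>i<length w. x i = w ! i}"

definition shift_topology :: "('a \<Rightarrow> 'a \<Rightarrow> bool) \<Rightarrow> (nat \<Rightarrow> 'a) topology" where
  "shift_topology S = topology_generated_by (range (cylinder S))"

lemma topspace_shift_topology: "topspace (shift_topology S) = markov_shift S"
proof -
  have "cylinder S w \<subseteq> markov_shift S" for w
    by (auto simp: cylinder_def)
  moreover have "cylinder S [] = markov_shift S"
    by (simp add: cylinder_def)
  ultimately show ?thesis
    unfolding shift_topology_def topology_generated_by_topspace by blast
qed

definition transitive_shift :: "('a \<Rightarrow> 'a \<Rightarrow> bool) \<Rightarrow> bool" where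
  "transitive_shift S \<longleftrightarrow>
     (\<forall>a b. \<exists>w. w \<noteq> [] \<and> successively S w \<and> hd w = a \<and> last w = b)"


section \<open>Invariant and ergodic measures\<close>

definition shift_borel :: "('a \<Rightarrow> 'a \<Rightarrow> bool) \<Rightarrow> (nat \<Rightarrow> 'a) measure" where
  "shift_borel S = sigma (markov_shift S) {U. openin (shift_topology S) U}"

lemma openin_shift_topology_subset: "{U. openin (shift_topology S) U} \<subseteq> Pow (markov_shift S)"
  using openin_subset topspace_shift_topology by blast

lemma space_shift_borel: "space (shift_borel S) = markov_shift S"
  unfolding shift_borel_def
  using openin_shift_topology_subset by (rule space_measure_of)

lemma sets_shift_borel:
  "sets (shift_borel S) = sigma_sets (markov_shift S) {U. openin (shift_topology S) U}"
  unfolding shift_borel_def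
  using openin_shift_topology_subset by (rule sets_measure_of)

definition invariant_measures :: "('a \<Rightarrow> 'a \<Rightarrow> bool) \<Rightarrow> (nat \<Rightarrow> 'a) measure set" where
  "invariant_measures S =
     {M. prob_space M \<and> sets M = sets (shift_borel S) \<and>
         (\<forall>B\<in>sets M. emeasure M (left_shift -` B \<inter> space M) = emeasure M B)}"

definition ergodic_measures :: "('a \<Rightarrow> 'a \<Rightarrow> bool) \<Rightarrow> (nat \<Rightarrow> 'a) measure set" where
  "ergodic_measures S =
     {M \<in> invariant_measures S.
        \<forall>B\<in>sets M. left_shift -` B \<inter> space M = B \<longrightarrow> measure M B = 0 \<or> measure M B = 1}"

text \<open>Weak* convergence; integrals only see the values on \<^term>\<open>space M = markov_shift S\<close>.\<close>

definition weak_star_converges ::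
    "('a \<Rightarrow> 'a \<Rightarrow> bool) \<Rightarrow> (nat \<Rightarrow> (nat \<Rightarrow> 'a) measure) \<Rightarrow> (nat \<Rightarrow> 'a) measure \<Rightarrow> bool" where
  "weak_star_converges S \<mu>s \<mu> \<longleftrightarrow>
     (\<forall>f :: (nat \<Rightarrow> 'a) \<Rightarrow> real.
        continuous_map (shift_topology S) euclideanreal f \<and> bounded (f ` markov_shift S) \<longrightarrow>
        (\<lambda>n. \<integral>x. f x \<partial>\<mu>s n) \<longlonglongrightarrow> (\<integral>x. f x \<partial>\<mu>))"


section \<open>Entropy and pressure\<close>

definition finite_measurable_partition :: "'x measure \<Rightarrow> 'x set set \<Rightarrow> bool" where
  "finite_measurable_partition M P \<longleftrightarrow> finite P \<and> partition_on (space M) P \<and> P \<subseteq> sets M"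

definition partition_entropy :: "'x measure \<Rightarrow> 'x set set \<Rightarrow> real" where
  "partition_entropy M P = - (\<Sum>C\<in>P. measure M C * ln (measure M C))"

text \<open>The join of \<open>P\<close>, \<open>T\<^sup>-\<^sup>1P\<close>, ..., \<open>T\<^sup>-\<^sup>(\<^sup>n\<^sup>-\<^sup>1\<^sup>)P\<close>, for \<open>n \<ge> 1\<close>.\<close>

definition iterated_join :: "'x measure \<Rightarrow> ('x \<Rightarrow> 'x) \<Rightarrow> 'x set set \<Rightarrow> nat \<Rightarrow> 'x set set" where
  "iterated_join M T P n =
     common_refinement ((\<lambda>i. (\<lambda>C. (T ^^ i) -` C \<inter> space M) ` P) ` {..<n})"

text \<open>For an invariant probability measure the limit exists, by subadditivity.\<close>

definition entropy_wrt_partition :: "'x measure \<Rightarrow> ('x \<Rightarrow> 'x) \<Rightarrow> 'x set set \<Rightarrow> real" where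
  "entropy_wrt_partition M T P =
     lim (\<lambda>n. partition_entropy M (iterated_join M T P n) / real n)"

definition ks_entropy :: "'x measure \<Rightarrow> ('x \<Rightarrow> 'x) \<Rightarrow> ereal" where
  "ks_entropy M T =
     (SUP P\<in>{P. finite_measurable_partition M P}. ereal (entropy_wrt_partition M T P))"

definition topological_entropy :: "('a \<Rightarrow> 'a \<Rightarrow> bool) \<Rightarrow> ereal" where
  "topological_entropy S = (SUP \<mu>\<in>ergodic_measures S. ks_entropy \<mu> left_shift)"

definition variation :: "('a \<Rightarrow> 'a \<Rightarrow> bool) \<Rightarrow> ((nat \<Rightarrow> 'a) \<Rightarrow> real) \<Rightarrow> nat \<Rightarrow> ereal" where
  "variation S \<phi> n =
     (SUP (x, y)\<in>{(x, y). x \<in> markov_shift S \<and> y \<in> markov_shift S \<and> (\<forall>i<n. x i = y i)}.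
        ereal (\<phi> x - \<phi> y))"

text \<open>The sum starts at \<open>var\<^sub>1\<close>.\<close>

definition summable_variations :: "('a \<Rightarrow> 'a \<Rightarrow> bool) \<Rightarrow> ((nat \<Rightarrow> 'a) \<Rightarrow> real) \<Rightarrow> bool" where
  "summable_variations S \<phi> \<longleftrightarrow> (\<Sum>n. variation S \<phi> (Suc n)) < \<infinity>"

text \<open>The Gurevich pressure, in the form given by the variational principle.\<close>

definition gurevich_pressure :: "('a \<Rightarrow> 'a \<Rightarrow> bool) \<Rightarrow> ((nat \<Rightarrow> 'a) \<Rightarrow> real) \<Rightarrow> ereal" where
  "gurevich_pressure S \<phi> =
     (SUP \<mu>\<in>invariant_measures S. ks_entropy \<mu> left_shift + ereal (\<integral>x. \<phi> x \<partial>\<mu>))"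

end

theory Submission
  imports Defs
begin

text \<open>Since \<open>\<phi>\<close> is bounded and continuous, its integrals converge, so the theorem amounts to upper
  semicontinuity of the entropy along the sequence. Fix a finite set \<open>F\<close> of symbols whose complement
  has small measure. Finite topological entropy forces the number of loops of length \<open>l\<close> at a symbol
  to grow at most exponentially in \<open>l\<close>: otherwise freely concatenating loops would give ergodic
  measures of arbitrarily large entropy. By transitivity the same holds, up to a constant factor, for
  excursions between two symbols of \<open>F\<close>. Enlarge \<open>F\<close> to a finite \<open>F'\<close> containing all symbols on
  short excursions. The excursions not visible to \<open>F'\<close> are then long, so the constant factor is
  harmless, and knowing the itinerary of a point with respect to \<open>F'\<close> determines its full itinerary
  up to an entropy proportional to the measure of the complement of \<open>F\<close>, uniformly along the
  sequence. The entropy with respect to the finite clopen partition given by \<open>F'\<close> is an infimum of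
  weak* continuous functions.\<close>

section \<open>Entropy of simple functions\<close>

text \<open>Over an infinite alphabet a small part of the mass may spread over ever more symbols and
  carry entropy that disappears in the limit. What controls this part is that the growth rate
  \<open>c\<close> of loops is the same for all symbols, and only the constant
  \<open>\<beta>\<close> depends on the finite set \<open>F\<close>. Hence the order of choices:
  \<open>c\<close> comes from the shift, then \<open>F\<close> with complement of measure small
  compared with \<open>1 / (c + 1)\<close>, then \<open>\<beta>\<close>, \<open>L\<close> and
  \<open>F'\<close> from \<open>F\<close>. Kolmogorov-Sinai entropy is a supremum over finite
  partitions, so the full itinerary is represented by names with respect to an arbitrary finite
  \<open>G\<close> containing \<open>F'\<close>, and every bound must be uniform in
  \<open>G\<close>. The only factor depending on \<open>G\<close>, namely
  \<open>ln (card G + 1)\<close>, multiplies the lengths of the two unfinished excursions at the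
  ends of a time window; ergodicity of the measures in the sequence makes these negligible.
  Conditional entropy is never introduced: Gibbs' inequality turns a count of fine words over a
  coarse one directly into an entropy bound.\<close>

definition obs_prob :: "'x measure \<Rightarrow> ('x \<Rightarrow> 'b) \<Rightarrow> 'b \<Rightarrow> real" where
  "obs_prob M X v = measure M (X -` {v} \<inter> space M)"

text \<open>Finite partitions are handled as level sets of simple functions: refinement becomes
  functional dependence, and a join becomes a pair or a list of values.\<close>

definition obs_entropy :: "'x measure \<Rightarrow> ('x \<Rightarrow> 'b) \<Rightarrow> real" where
  "obs_entropy M X = - (\<Sum>v\<in>X ` space M. obs_prob M X v * ln (obs_prob M X v))"

lemma obs_prob_nonneg [simp]: "0 \<le> obs_prob M X v"
  by (simp add: obs_prob_def)

lemma obs_prob_eq_0: "v \<notin> X ` space M \<Longrightarrow> obs_prob M X v = 0"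
proof -
  assume "v \<notin> X ` space M"
  then have "X -` {v} \<inter> space M = {}" by auto
  then show ?thesis by (simp add: obs_prob_def)
qed

text \<open>Values that are not attained contribute nothing, so the sum may run over an index set
  common to all measures.\<close>

lemma obs_entropy_superset:
  assumes "finite V" "X ` space M \<subseteq> V"
  shows "obs_entropy M X = - (\<Sum>v\<in>V. obs_prob M X v * ln (obs_prob M X v))"
proof -
  have "(\<Sum>v\<in>X ` space M. obs_prob M X v * ln (obs_prob M X v)) =
      (\<Sum>v\<in>V. obs_prob M X v * ln (obs_prob M X v))"
    using assms by (intro sum.mono_neutral_left) (auto simp: obs_prob_eq_0)
  then show ?thesis by (simp add: obs_entropy_def)
qed

section \<open>Elementary inequalities for \<open>- (t * ln t)\<close>\<close>

lemma neg_xlnx_le_one_minus: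
  fixes t :: real
  assumes "0 \<le> t"
  shows "- (t * ln t) \<le> 1 - t"
proof (cases "t = 0")
  case False
  then have "ln (1 / t) \<le> 1 / t - 1" using assms by (intro ln_le_minus_one) auto
  then have "t * ln (1 / t) \<le> t * (1 / t - 1)" using assms by (intro mult_left_mono)
  then show ?thesis using False assms by (simp add: ln_div algebra_simps)
qed auto

text \<open>An explicit modulus of continuity at 0, from \<open>ln s \<le> s - 1\<close> at
  \<open>s = 1 / sqrt t\<close>. It serves both to bound the entropy of almost constant observables
  and to pass to weak* limits.\<close>

lemma neg_xlnx_le_sqrt:
  fixes t :: real
  assumes "0 \<le> t"
  shows "- (t * ln t) \<le> 2 * sqrt t"
proof (cases "t = 0")
  case False
  then have t: "t > 0" using assms by auto
  have "- ln (sqrt t) = ln (1 / sqrt t)" using t by (simp add: ln_div)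
  also have "\<dots> \<le> 1 / sqrt t - 1" using t by (intro ln_le_minus_one) auto
  finally have "- ln (sqrt t) \<le> 1 / sqrt t" by simp
  then have "t * (- ln (sqrt t)) \<le> t * (1 / sqrt t)" using t by (intro mult_left_mono) auto
  also have "t * (1 / sqrt t) = sqrt t" using t by (simp add: real_div_sqrt)
  finally show ?thesis using t by (simp add: ln_sqrt)
qed auto

text \<open>Nonnegativity of relative entropy, from \<open>ln t \<le> t - 1\<close>. The comparison
  weights \<open>q\<close> may have less total mass than \<open>p\<close>, so they can be guessed
  without normalising them.\<close>

lemma gibbs_inequality:
  fixes p q :: "'b \<Rightarrow> real"
  assumes "\<And>v. v \<in> V \<Longrightarrow> 0 \<le> p v" "\<And>v. v \<in> V \<Longrightarrow> 0 \<le> q v"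
    and pos: "\<And>v. v \<in> V \<Longrightarrow> 0 < p v \<Longrightarrow> 0 < q v"
    and le: "sum q V \<le> sum p V"
  shows "- (\<Sum>v\<in>V. p v * ln (p v)) \<le> - (\<Sum>v\<in>V. p v * ln (q v))"
proof -
  have "p v * ln (q v) - p v * ln (p v) \<le> q v - p v" if v: "v \<in> V" for v
  proof (cases "p v = 0")
    case True then show ?thesis using assms(2)[OF v] by simp
  next
    case False
    then have p: "p v > 0" using assms(1)[OF v] by auto
    then have q: "q v > 0" using pos[OF v] by auto
    have "ln (q v / p v) \<le> q v / p v - 1" using p q by (intro ln_le_minus_one) auto
    then have "p v * ln (q v / p v) \<le> p v * (q v / p v - 1)" using p by (intro mult_left_mono) auto
    then show ?thesis using p q by (simp add: ln_div algebra_simps)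
  qed
  then have "(\<Sum>v\<in>V. p v * ln (q v) - p v * ln (p v)) \<le> (\<Sum>v\<in>V. q v - p v)"
    by (rule sum_mono)
  then show ?thesis using le by (simp add: sum_subtractf)
qed

context prob_space
begin

lemma expectation_simple_function:
  fixes g :: "'b \<Rightarrow> real"
  assumes "simple_function M X"
  shows "(\<Sum>v\<in>X ` space M. obs_prob M X v * g v) = (\<integral>x. g (X x) \<partial>M)"
proof -
  have fin: "finite (X ` space M)" using simple_functionD(1)[OF assms] .
  have "(\<integral>x. g (X x) \<partial>M) = (\<integral>x. (\<Sum>v\<in>X ` space M. g v * indicator (X -` {v} \<inter> space M) x) \<partial>M)"
  proof (rule Bochner_Integration.integral_cong[OF refl])
    fix x assume x: "x \<in> space M"
    have "(\<Sum>v\<in>X ` space M. g v * indicator (X -` {v} \<inter> space M) x) =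
      (\<Sum>v\<in>X ` space M. if v = X x then g v else 0)"
      using x by (intro sum.cong) (auto simp: indicator_def)
    also have "\<dots> = g (X x)" using fin x by (simp add: sum.delta)
    finally show "g (X x) = (\<Sum>v\<in>X ` space M. g v * indicator (X -` {v} \<inter> space M) x)" by simp
  qed
  also have "\<dots> = (\<Sum>v\<in>X ` space M. \<integral>x. g v * indicator (X -` {v} \<inter> space M) x \<partial>M)"
    using simple_functionD(2)[OF assms]
    by (intro Bochner_Integration.integral_sum integrable_mult_right)
      (auto simp: less_top[symmetric])
  also have "\<dots> = (\<Sum>v\<in>X ` space M. obs_prob M X v * g v)"
    by (simp add: obs_prob_def mult.commute)
  finally show ?thesis by simp
qed

lemma integrable_comp_simple_function:
  fixes g :: "'b \<Rightarrow> real"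
  assumes "simple_function M X"
  shows "integrable M (\<lambda>x. g (X x))"
proof -
  have "simple_function M (\<lambda>x. g (X x))" using assms by (rule simple_function_compose1)
  then show ?thesis
    by (intro integrableI_simple_bochner_integrable simple_bochner_integrable.intros)
      (auto simp: emeasure_finite)
qed

lemma sum_obs_prob: "simple_function M X \<Longrightarrow> (\<Sum>v\<in>X ` space M. obs_prob M X v) = 1"
  using expectation_simple_function[of X "\<lambda>_. 1"] by (simp add: prob_space)

lemma obs_prob_le_1: "obs_prob M X v \<le> 1"
  by (simp add: obs_prob_def)

lemma obs_entropy_eq_expectation:
  "simple_function M X \<Longrightarrow> obs_entropy M X = - (\<integral>x. ln (obs_prob M X (X x)) \<partial>M)"
  using expectation_simple_function[of X "\<lambda>v. ln (obs_prob M X v)"]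
  by (simp add: obs_entropy_def)

lemma obs_entropy_nonneg: "0 \<le> obs_entropy M X"
proof -
  have "obs_prob M X v * ln (obs_prob M X v) \<le> 0" for v
  proof (cases "obs_prob M X v = 0")
    case False
    then have "0 < obs_prob M X v" using obs_prob_nonneg[of M X v] by linarith
    then have "ln (obs_prob M X v) \<le> 0"
      using ln_le_minus_one[of "obs_prob M X v"] obs_prob_le_1[of X v] by linarith
    then show ?thesis by (simp add: mult_nonneg_nonpos)
  qed simp
  then show ?thesis unfolding obs_entropy_def by (simp add: sum_nonpos)
qed

lemma obs_prob_mono:
  assumes "simple_function M X" "\<And>y. y \<in> space M \<Longrightarrow> Y y = Y x \<Longrightarrow> X y = X x"
  shows "obs_prob M Y (Y x) \<le> obs_prob M X (X x)"
  unfolding obs_prob_def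
  using assms simple_functionD(2)[OF assms(1)] by (intro finite_measure_mono) auto

lemma AE_obs_prob_pos:
  assumes X: "simple_function M X"
  shows "AE x in M. 0 < obs_prob M X (X x)"
proof -
  have "AE x in M. \<forall>v\<in>X ` space M. obs_prob M X v = 0 \<longrightarrow> X x \<noteq> v"
  proof (intro AE_finite_allI simple_functionD(1)[OF X])
    fix v assume "v \<in> X ` space M"
    show "AE x in M. obs_prob M X v = 0 \<longrightarrow> X x \<noteq> v"
    proof (cases "obs_prob M X v = 0")
      case True
      then have "X -` {v} \<inter> space M \<in> null_sets M"
        using simple_functionD(2)[OF X] by (auto simp: obs_prob_def emeasure_eq_measure)
      then show ?thesis by (rule AE_I') auto
    qed auto
  qed
  then show ?thesis
  proof (rule AE_mp, intro AE_I2 impI)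
    fix x assume "x \<in> space M" "\<forall>v\<in>X ` space M. obs_prob M X v = 0 \<longrightarrow> X x \<noteq> v"
    then have "obs_prob M X (X x) \<noteq> 0" by auto
    then show "0 < obs_prob M X (X x)" using obs_prob_nonneg[of M X "X x"] by linarith
  qed
qed

text \<open>A level set of the finer observable has the smaller probability. The logarithms are
  compared almost everywhere only, since a level set may be null.\<close>

lemma obs_entropy_mono:
  assumes X: "simple_function M X" and Y: "simple_function M Y"
    and XY: "\<And>x y. x \<in> space M \<Longrightarrow> y \<in> space M \<Longrightarrow> Y x = Y y \<Longrightarrow> X x = X y"
  shows "obs_entropy M X \<le> obs_entropy M Y"
proof -
  have "(\<integral>x. ln (obs_prob M Y (Y x)) \<partial>M) \<le> (\<integral>x. ln (obs_prob M X (X x)) \<partial>M)"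
  proof (rule integral_mono_AE)
    show "integrable M (\<lambda>x. ln (obs_prob M Y (Y x)))"
      by (rule integrable_comp_simple_function[OF Y])
    show "integrable M (\<lambda>x. ln (obs_prob M X (X x)))"
      by (rule integrable_comp_simple_function[OF X])
    show "AE x in M. ln (obs_prob M Y (Y x)) \<le> ln (obs_prob M X (X x))"
      using AE_obs_prob_pos[OF Y]
    proof (rule AE_mp, intro AE_I2 impI)
      fix x assume x: "x \<in> space M" "0 < obs_prob M Y (Y x)"
      have "obs_prob M Y (Y x) \<le> obs_prob M X (X x)"
        using XY[OF _ x(1)] by (intro obs_prob_mono X) auto
      then show "ln (obs_prob M Y (Y x)) \<le> ln (obs_prob M X (X x))" using x(2) by simp
    qed
  qed
  then show ?thesis by (simp add: obs_entropy_eq_expectation X Y)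
qed

text \<open>Gibbs' inequality for the joint law against the product of the two marginals.\<close>

lemma obs_entropy_Pair_le:
  assumes X: "simple_function M X" and Y: "simple_function M Y"
  shows "obs_entropy M (\<lambda>x. (X x, Y x)) \<le> obs_entropy M X + obs_entropy M Y"
proof -
  let ?Z = "\<lambda>x. (X x, Y x)"
  let ?V = "X ` space M \<times> Y ` space M"
  let ?p = "obs_prob M ?Z"
  let ?q = "\<lambda>v. obs_prob M X (fst v) * obs_prob M Y (snd v)"
  have Z: "simple_function M ?Z" using X Y by auto
  have fin: "finite ?V" using simple_functionD(1)[OF X] simple_functionD(1)[OF Y] by auto
  have img: "?Z ` space M \<subseteq> ?V" by auto
  have ext: "(\<Sum>v\<in>?V. ?p v * g v) = (\<integral>x. g (?Z x) \<partial>M)" for g :: "_ \<Rightarrow> real"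
  proof -
    have "(\<Sum>v\<in>?V. ?p v * g v) = (\<Sum>v\<in>?Z ` space M. ?p v * g v)"
      using fin img by (intro sum.mono_neutral_right) (auto simp: obs_prob_eq_0)
    then show ?thesis using expectation_simple_function[OF Z, of g] by simp
  qed
  have pos: "0 < obs_prob M X u \<and> 0 < obs_prob M Y w" if "0 < ?p (u, w)" for u w
  proof -
    have "?p (u, w) \<le> obs_prob M X u"
      unfolding obs_prob_def using simple_functionD(2)[OF X] by (intro finite_measure_mono) auto
    moreover have "?p (u, w) \<le> obs_prob M Y w"
      unfolding obs_prob_def using simple_functionD(2)[OF Y] by (intro finite_measure_mono) auto
    ultimately show ?thesis using that by auto
  qed
  have "obs_entropy M ?Z = - (\<Sum>v\<in>?V. ?p v * ln (?p v))"
    using fin img by (rule obs_entropy_superset)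
  also have "\<dots> \<le> - (\<Sum>v\<in>?V. ?p v * ln (?q v))"
  proof (rule gibbs_inequality)
    have "sum ?q ?V = (\<Sum>u\<in>X ` space M. obs_prob M X u) * (\<Sum>w\<in>Y ` space M. obs_prob M Y w)"
      by (simp add: sum_product sum.cartesian_product split_beta)
    also have "\<dots> = 1" by (simp add: sum_obs_prob X Y)
    also have "\<dots> = sum ?p ?V" using ext[of "\<lambda>_. 1"] by (simp add: prob_space)
    finally show "sum ?q ?V \<le> sum ?p ?V" by simp
  qed (use pos in auto)
  also have "(\<Sum>v\<in>?V. ?p v * ln (?q v)) =
      (\<Sum>v\<in>?V. ?p v * (ln (obs_prob M X (fst v)) + ln (obs_prob M Y (snd v))))"
  proof (intro sum.cong refl)
    fix v assume "v \<in> ?V"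
    show "?p v * ln (?q v) = ?p v * (ln (obs_prob M X (fst v)) + ln (obs_prob M Y (snd v)))"
    proof (cases "?p v = 0")
      case False
      then have "0 < ?p (fst v, snd v)" using obs_prob_nonneg[of M ?Z v] by (simp del: obs_prob_nonneg)
      from pos[OF this] show ?thesis by (simp add: ln_mult)
    qed simp
  qed
  also have "\<dots> = (\<integral>x. ln (obs_prob M X (X x)) + ln (obs_prob M Y (Y x)) \<partial>M)"
    by (subst ext) simp
  also have "\<dots> = (\<integral>x. ln (obs_prob M X (X x)) \<partial>M) + (\<integral>x. ln (obs_prob M Y (Y x)) \<partial>M)"
    by (intro Bochner_Integration.integral_add integrable_comp_simple_function X Y)
  finally show ?thesis by (simp add: obs_entropy_eq_expectation X Y)
qed

text \<open>Conditionally on \<open>f \<circ> X\<close>, the entropy of \<open>X\<close> is at most the expected logarithm of the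
  number of values still possible.\<close>

lemma obs_entropy_le_image_plus_log_fibers:
  assumes X: "simple_function M X"
    and card: "\<And>x. x \<in> space M \<Longrightarrow>
      real (card {v \<in> X ` space M. f v = f (X x)}) \<le> exp (b (f (X x)))"
  shows "obs_entropy M X \<le> obs_entropy M (\<lambda>x. f (X x)) + (\<integral>x. b (f (X x)) \<partial>M)"
proof -
  let ?V = "X ` space M" and ?Y = "\<lambda>x. f (X x)"
  \<comment> \<open>The test weights spread the law of \<open>f \<circ> X\<close> over its fibres
    with density \<open>exp (- b)\<close>. A fibre has at most \<open>exp b\<close> points, so their
    total mass is at most one.\<close>
  let ?q = "\<lambda>v. obs_prob M ?Y (f v) * exp (- b (f v))"
  have fin: "finite ?V" using simple_functionD(1)[OF X] .
  have Y: "simple_function M ?Y" using X by (rule simple_function_compose1)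
  have le: "obs_prob M X v \<le> obs_prob M ?Y (f v)" for v
    unfolding obs_prob_def using simple_functionD(2)[OF Y] by (intro finite_measure_mono) auto
  have "obs_entropy M X \<le> - (\<Sum>v\<in>?V. obs_prob M X v * ln (?q v))"
    unfolding obs_entropy_def
  proof (rule gibbs_inequality)
    have "sum ?q ?V = (\<Sum>y\<in>f ` ?V. \<Sum>v\<in>{v\<in>?V. f v = y}. ?q v)"
      by (rule sum.image_gen[OF fin])
    also have "\<dots> = (\<Sum>y\<in>f ` ?V. \<Sum>v\<in>{v\<in>?V. f v = y}. obs_prob M ?Y y * exp (- b y))"
      by (intro sum.cong) auto
    also have "\<dots> = (\<Sum>y\<in>f ` ?V. obs_prob M ?Y y * (real (card {v\<in>?V. f v = y}) * exp (- b y)))"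
      by (simp add: algebra_simps)
    also have "\<dots> \<le> (\<Sum>y\<in>f ` ?V. obs_prob M ?Y y)"
    proof (rule sum_mono)
      fix y assume "y \<in> f ` ?V"
      then have "real (card {v\<in>?V. f v = y}) \<le> exp (b y)" using card by auto
      then have "real (card {v\<in>?V. f v = y}) * exp (- b y) \<le> 1"
        by (simp add: exp_minus divide_inverse[symmetric])
      then show "obs_prob M ?Y y * (real (card {v\<in>?V. f v = y}) * exp (- b y)) \<le> obs_prob M ?Y y"
        by (simp add: mult_left_le)
    qed
    also have "\<dots> = 1" using sum_obs_prob[OF Y] by (simp add: image_comp comp_def)
    also have "\<dots> = sum (obs_prob M X) ?V" by (simp add: sum_obs_prob X)
    finally show "sum ?q ?V \<le> sum (obs_prob M X) ?V" .
  next
    fix v assume "0 < obs_prob M X v"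
    then have "0 < obs_prob M ?Y (f v)" using le[of v] by linarith
    then show "0 < ?q v" by simp
  qed auto
  also have "(\<Sum>v\<in>?V. obs_prob M X v * ln (?q v)) =
      (\<Sum>v\<in>?V. obs_prob M X v * (ln (obs_prob M ?Y (f v)) - b (f v)))"
  proof (intro sum.cong refl)
    fix v assume "v \<in> ?V"
    show "obs_prob M X v * ln (?q v) = obs_prob M X v * (ln (obs_prob M ?Y (f v)) - b (f v))"
    proof (cases "obs_prob M X v = 0")
      case False
      then have "0 < obs_prob M ?Y (f v)" using le[of v] obs_prob_nonneg[of M X v] by linarith
      then show ?thesis by (simp add: ln_mult)
    qed simp
  qed
  also have "\<dots> = (\<integral>x. ln (obs_prob M ?Y (f (X x))) - b (f (X x)) \<partial>M)"
    by (rule expectation_simple_function[OF X])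
  also have "\<dots> = (\<integral>x. ln (obs_prob M ?Y (?Y x)) \<partial>M) - (\<integral>x. b (?Y x) \<partial>M)"
    by (intro Bochner_Integration.integral_diff integrable_comp_simple_function[OF Y])
  finally show ?thesis by (simp add: obs_entropy_eq_expectation X Y)
qed

text \<open>Minus the logarithm of the probability of the observed value is almost everywhere at
  least \<open>a\<close>, and its mean is the entropy.\<close>

lemma obs_entropy_ge_of_max_prob:
  assumes X: "simple_function M X" and "\<And>v. obs_prob M X v \<le> exp (- a)"
  shows "a \<le> obs_entropy M X"
proof -
  have "(\<integral>x. ln (obs_prob M X (X x)) \<partial>M) \<le> (\<integral>x. - a \<partial>M)"
  proof (rule integral_mono_AE)
    show "integrable M (\<lambda>x. ln (obs_prob M X (X x)))"
      by (rule integrable_comp_simple_function[OF X])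
    show "AE x in M. ln (obs_prob M X (X x)) \<le> - a"
      using AE_obs_prob_pos[OF X]
    proof (rule AE_mp, intro AE_I2 impI)
      fix x assume "0 < obs_prob M X (X x)"
      then have "ln (obs_prob M X (X x)) \<le> ln (exp (- a))" using assms(2)[of "X x"]
        by (subst ln_le_cancel_iff) auto
      then show "ln (obs_prob M X (X x)) \<le> - a" by simp
    qed
  qed simp
  then show ?thesis by (simp add: obs_entropy_eq_expectation X prob_space)
qed

text \<open>All values other than \<open>u\<close> share mass at most \<open>s\<close>, so each
  contributes at most \<open>2 * sqrt s\<close>, and \<open>u\<close> contributes at most
  \<open>s\<close>. For fixed \<open>V\<close> the bound tends to 0 with \<open>s\<close>.\<close>

lemma obs_entropy_le_of_dominant_value:
  assumes X: "simple_function M X" and V: "finite V" "X ` space M \<subseteq> V" and "u \<in> V"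
    and s: "1 - obs_prob M X u \<le> s"
  shows "obs_entropy M X \<le> s + real (card V) * (2 * sqrt s)"
proof -
  let ?p = "obs_prob M X"
  have sum1: "sum ?p V = 1"
  proof -
    have "sum ?p V = sum ?p (X ` space M)"
      using V by (intro sum.mono_neutral_right) (auto simp: obs_prob_eq_0)
    then show ?thesis using sum_obs_prob[OF X] by simp
  qed
  have s0: "0 \<le> s" using s obs_prob_le_1[of X u] by linarith
  have other: "- (?p v * ln (?p v)) \<le> 2 * sqrt s" if v: "v \<in> V - {u}" for v
  proof -
    have "?p v \<le> sum ?p (V - {u})" using V v by (intro member_le_sum) auto
    also have "\<dots> = 1 - ?p u" using V \<open>u \<in> V\<close> sum1 by (simp add: sum_diff1)
    finally have "sqrt (?p v) \<le> sqrt s" using s by simp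
    then show ?thesis using neg_xlnx_le_sqrt[OF obs_prob_nonneg, of M X v] by linarith
  qed
  have "obs_entropy M X = (\<Sum>v\<in>V. - (?p v * ln (?p v)))"
    using V by (simp add: obs_entropy_superset sum_negf)
  also have "\<dots> = - (?p u * ln (?p u)) + (\<Sum>v\<in>V - {u}. - (?p v * ln (?p v)))"
    using V \<open>u \<in> V\<close> by (simp add: sum.remove)
  also have "(\<Sum>v\<in>V - {u}. - (?p v * ln (?p v))) \<le> real (card (V - {u})) * (2 * sqrt s)"
    by (rule sum_bounded_above) (use other in blast)
  also have "\<dots> \<le> real (card V) * (2 * sqrt s)"
    using V s0 by (intro mult_right_mono) (auto simp: card_mono)
  also have "- (?p u * ln (?p u)) \<le> s"
    using neg_xlnx_le_one_minus[of "?p u"] s by simp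
  finally show ?thesis by simp
qed

end

text \<open>The limit is the infimum over \<open>n \<ge> 1\<close>. Subadditivity gives the upper
  estimate by division with remainder by an index \<open>m\<close> whose quotient is close to the
  infimum.\<close>

lemma fekete_subadditive:
  fixes a :: "nat \<Rightarrow> real"
  assumes sub: "\<And>m n. a (m + n) \<le> a m + a n" and nonneg: "\<And>n. 0 \<le> a n"
  shows "convergent (\<lambda>n. a n / real n)"
    and "1 \<le> n \<Longrightarrow> lim (\<lambda>n. a n / real n) \<le> a n / real n"
proof -
  define L where "L = (INF n\<in>{1..}. a n / real n)"
  have bdd: "bdd_below ((\<lambda>n. a n / real n) ` {1..})"
    using nonneg by (intro bdd_belowI[of _ 0]) auto
  have L_le: "L \<le> a n / real n" if "1 \<le> n" for n
    unfolding L_def using that by (intro cINF_lower bdd) auto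
  have mult: "a (q * m) \<le> real q * a m + a 0" for q m
  proof (induction q)
    case (Suc q)
    have "a (Suc q * m) \<le> a m + a (q * m)" using sub[of m "q * m"] by simp
    then show ?case using Suc by (simp add: algebra_simps)
  qed simp
  have lim: "(\<lambda>n. a n / real n) \<longlonglongrightarrow> L"
  proof (rule order_tendstoI)
    fix c assume "c < L"
    show "\<forall>\<^sub>F n in sequentially. c < a n / real n"
      by (rule eventually_mono[OF eventually_ge_at_top[of 1]])
        (use L_le \<open>c < L\<close> in \<open>blast intro: less_le_trans\<close>)
  next
    fix c assume "L < c"
    then obtain m where m: "1 \<le> m" "a m / real m < c"
      unfolding L_def using cINF_less_iff[OF _ bdd] by auto
    \<comment> \<open>\<open>K\<close> absorbs the value at the remainder \<open>n mod m\<close> and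
      the term \<open>a 0\<close>, which need not vanish.\<close>
    define K where "K = a 0 + Max (a ` {..<m})"
    have bound: "a n / real n \<le> a m / real m + K / real n" if n: "1 \<le> n" for n
    proof -
      have "a n \<le> a (n div m * m) + a (n mod m)" using sub[of "n div m * m" "n mod m"] by simp
      also have "\<dots> \<le> real (n div m) * a m + K"
      proof -
        have "a (n mod m) \<le> Max (a ` {..<m})" using m(1) by (intro Max_ge) auto
        then show ?thesis using mult[of "n div m" m] by (simp add: K_def)
      qed
      also have "real (n div m) * a m \<le> (real n / real m) * a m"
        by (intro mult_right_mono nonneg of_nat_div_le_of_nat)
      finally have "a n \<le> real n * (a m / real m) + K" by simp
      then show ?thesis using n by (simp add: field_simps)
    qed
    have "(\<lambda>n. a m / real m + K / real n) \<longlonglongrightarrow> a m / real m + 0"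
      by (intro tendsto_intros lim_const_over_n)
    then have "\<forall>\<^sub>F n in sequentially. a m / real m + K / real n < c"
      using m(2) by (intro order_tendstoD(2)) auto
    then show "\<forall>\<^sub>F n in sequentially. a n / real n < c"
      using eventually_ge_at_top[of 1] by eventually_elim (use bound in force)
  qed
  show "convergent (\<lambda>n. a n / real n)" using lim by (rule convergentI)
  show "lim (\<lambda>n. a n / real n) \<le> a n / real n" if "1 \<le> n"
    using limI[OF lim] L_le[OF that] by simp
qed

section \<open>Entropy rates and Kolmogorov-Sinai entropy\<close>

locale measure_preserving_map = prob_space +
  fixes T :: "'a \<Rightarrow> 'a"
  assumes T_measurable: "T \<in> measurable M M"
    and T_invariant: "\<And>B. B \<in> sets M \<Longrightarrow> emeasure M (T -` B \<inter> space M) = emeasure M B"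

definition itinerary :: "('x \<Rightarrow> 'x) \<Rightarrow> ('x \<Rightarrow> 'b) \<Rightarrow> nat \<Rightarrow> 'x \<Rightarrow> 'b list" where
  "itinerary T X n x = map (\<lambda>i. X ((T ^^ i) x)) [0..<n]"

definition entropy_rate :: "'x measure \<Rightarrow> ('x \<Rightarrow> 'x) \<Rightarrow> ('x \<Rightarrow> 'b) \<Rightarrow> real" where
  "entropy_rate M T X = lim (\<lambda>n. obs_entropy M (itinerary T X n) / real n)"

lemma itinerary_0 [simp]: "itinerary T X 0 x = []"
  by (simp add: itinerary_def)

lemma length_itinerary [simp]: "length (itinerary T X n x) = n"
  by (simp add: itinerary_def)

lemma nth_itinerary [simp]: "i < n \<Longrightarrow> itinerary T X n x ! i = X ((T ^^ i) x)"
  by (simp add: itinerary_def)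

lemma itinerary_eq_iff:
  "itinerary T X n x = itinerary T X n y \<longleftrightarrow> (\<forall>i<n. X ((T ^^ i) x) = X ((T ^^ i) y))"
  by (auto simp: list_eq_iff_nth_eq)

lemma itinerary_add: "itinerary T X (m + n) x = itinerary T X m x @ itinerary T X n ((T ^^ m) x)"
proof -
  have "(T ^^ i) ((T ^^ m) x) = (T ^^ (i + m)) x" for i by (simp add: funpow_add)
  then show ?thesis by (intro nth_equalityI) (auto simp: nth_append)
qed

context measure_preserving_map
begin

lemma T_space: "x \<in> space M \<Longrightarrow> T x \<in> space M"
  using T_measurable by (rule measurable_space)

lemma funpow_measurable: "T ^^ n \<in> measurable M M"
  using measurable_compose_n[OF T_measurable] .

lemma funpow_space: "x \<in> space M \<Longrightarrow> (T ^^ n) x \<in> space M"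
  using funpow_measurable by (rule measurable_space)

lemma measure_funpow_vimage:
  assumes B: "B \<in> sets M"
  shows "measure M ((T ^^ n) -` B \<inter> space M) = measure M B"
proof (induction n)
  case 0
  then show ?case using sets.sets_into_space[OF B] by (simp add: Int_absorb2)
next
  case (Suc n)
  let ?C = "(T ^^ n) -` B \<inter> space M"
  have C: "?C \<in> sets M" using measurable_sets[OF funpow_measurable B] .
  have "(T ^^ Suc n) -` B \<inter> space M = T -` ?C \<inter> space M"
    using T_space by (auto simp: funpow_swap1)
  then have "measure M ((T ^^ Suc n) -` B \<inter> space M) = measure M ?C"
    using T_invariant[OF C] by (simp only: measure_def)
  then show ?case using Suc by (simp only:)
qed

lemma simple_function_funpow:
  "simple_function M X \<Longrightarrow> simple_function M (\<lambda>x. X ((T ^^ n) x))"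
  by (rule simple_function_comp[OF funpow_measurable])

lemma simple_function_itinerary:
  assumes "simple_function M X"
  shows "simple_function M (itinerary T X n)"
proof (induction n)
  case (Suc n)
  have "itinerary T X (Suc n) = (\<lambda>x. itinerary T X n x @ [X ((T ^^ n) x)])"
    by (auto simp: itinerary_def)
  then show ?case
    using simple_function_compose2[OF Suc simple_function_funpow[OF assms, of n],
        of "\<lambda>u v. u @ [v]"] by simp
qed (simp add: itinerary_def)

lemma obs_entropy_funpow:
  assumes X: "simple_function M X"
  shows "obs_entropy M (\<lambda>x. X ((T ^^ n) x)) = obs_entropy M X"
proof -
  have "obs_prob M (\<lambda>x. X ((T ^^ n) x)) v = obs_prob M X v" for v
  proof -
    have "(\<lambda>x. X ((T ^^ n) x)) -` {v} \<inter> space M = (T ^^ n) -` (X -` {v} \<inter> space M) \<inter> space M"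
      using funpow_space by auto
    then show ?thesis
      using measure_funpow_vimage[OF simple_functionD(2)[OF X]] by (simp add: obs_prob_def)
  qed
  moreover have "(\<lambda>x. X ((T ^^ n) x)) ` space M \<subseteq> X ` space M"
    using funpow_space by auto
  ultimately show ?thesis
    by (simp add: obs_entropy_superset[OF simple_functionD(1)[OF X]])
qed

lemma obs_entropy_itinerary_add:
  assumes X: "simple_function M X"
  shows "obs_entropy M (itinerary T X (m + n)) \<le>
    obs_entropy M (itinerary T X m) + obs_entropy M (itinerary T X n)"
proof -
  let ?P = "\<lambda>x. (itinerary T X m x, itinerary T X n ((T ^^ m) x))"
  have m: "simple_function M (itinerary T X m)" and n: "simple_function M (itinerary T X n)"
    using X by (auto intro: simple_function_itinerary)
  note n' = simple_function_funpow[OF n, of m]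
  have "obs_entropy M (itinerary T X (m + n)) \<le> obs_entropy M ?P"
    using X m n' by (intro obs_entropy_mono simple_function_itinerary simple_function_Pair)
      (auto simp: itinerary_add)
  also have "\<dots> \<le> obs_entropy M (itinerary T X m) + obs_entropy M (itinerary T X n)"
    using obs_entropy_Pair_le[OF m n'] obs_entropy_funpow[OF n] by simp
  finally show ?thesis .
qed

lemma entropy_rate_lim:
  assumes "simple_function M X"
  shows "(\<lambda>n. obs_entropy M (itinerary T X n) / real n) \<longlonglongrightarrow> entropy_rate M T X"
  unfolding entropy_rate_def convergent_LIMSEQ_iff[symmetric]
  by (rule fekete_subadditive(1)) (auto intro: obs_entropy_itinerary_add assms obs_entropy_nonneg)

lemma entropy_rate_le:
  assumes "simple_function M X" "1 \<le> n"
  shows "entropy_rate M T X \<le> obs_entropy M (itinerary T X n) / real n"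
  unfolding entropy_rate_def
  by (rule fekete_subadditive(2))
    (auto intro: obs_entropy_itinerary_add assms obs_entropy_nonneg simp: assms(2)[simplified])

text \<open>Subadditivity with steps of length one. This is what makes an almost constant observable
  cheap per unit of time.\<close>

lemma obs_entropy_itinerary_le:
  assumes X: "simple_function M X"
  shows "obs_entropy M (itinerary T X n) \<le> real n * obs_entropy M X"
proof (induction n)
  case 0
  \<comment> \<open>The empty itinerary is constant, so the dominant value bound applies with
    \<open>s = 0\<close>.\<close>
  have "obs_entropy M (itinerary T X 0) \<le> 0"
    using obs_entropy_le_of_dominant_value[OF simple_function_itinerary[OF X, of 0], of "{[]}" "[]" 0]
    by (auto simp: obs_prob_def vimage_def prob_space)
  then show ?case by (simp only: of_nat_0 mult_zero_left)
next
  case (Suc n)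
  have "obs_entropy M (itinerary T X 1) = obs_entropy M X"
  proof (rule antisym)
    show "obs_entropy M (itinerary T X 1) \<le> obs_entropy M X"
      using X by (intro obs_entropy_mono simple_function_itinerary) (auto simp: itinerary_eq_iff)
    show "obs_entropy M X \<le> obs_entropy M (itinerary T X 1)"
      using X by (intro obs_entropy_mono simple_function_itinerary) (auto simp: itinerary_eq_iff)
  qed
  then show ?case using obs_entropy_itinerary_add[OF X, of n 1] Suc by (simp add: algebra_simps)
qed

end

section \<open>Level-set partitions and Kolmogorov-Sinai entropy\<close>

definition obs_partition :: "'x measure \<Rightarrow> ('x \<Rightarrow> 'b) \<Rightarrow> 'x set set" where
  "obs_partition M X = (\<lambda>v. X -` {v} \<inter> space M) ` (X ` space M)"

lemma partition_entropy_obs_partition: "partition_entropy M (obs_partition M X) = obs_entropy M X"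
proof -
  have "inj_on (\<lambda>v. X -` {v} \<inter> space M) (X ` space M)" by (auto simp: inj_on_def)
  then show ?thesis
    unfolding partition_entropy_def obs_entropy_def obs_partition_def obs_prob_def
    by (simp add: sum.reindex)
qed

context measure_preserving_map
begin

text \<open>A nonempty intersection of one cell per time is the set of points that share the
  itinerary of any of its members. For \<open>n = 0\<close> the empty intersection would be
  \<open>UNIV\<close>, which is why a positive length is required.\<close>

lemma iterated_join_obs_partition:
  assumes "1 \<le> n"
  shows "iterated_join M T (obs_partition M X) n = obs_partition M (itinerary T X n)"
proof -
  let ?cell = "\<lambda>i x. {y \<in> space M. X ((T ^^ i) y) = X ((T ^^ i) x)}"
  define fam where "fam i = (\<lambda>C. (T ^^ i) -` C \<inter> space M) ` obs_partition M X" for i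
  have cell_fam: "?cell i x \<in> fam i" if x: "x \<in> space M" for i x
  proof -
    let ?C = "X -` {X ((T ^^ i) x)} \<inter> space M"
    have "?cell i x = (T ^^ i) -` ?C \<inter> space M" using funpow_space by auto
    moreover have "?C \<in> obs_partition M X"
      unfolding obs_partition_def using funpow_space[OF x] by blast
    ultimately show ?thesis unfolding fam_def by blast
  qed
  have fam_cell: "D = ?cell i x" if "D \<in> fam i" "x \<in> D" for D i x
    using that funpow_space unfolding fam_def obs_partition_def by auto
  have fiber: "itinerary T X n -` {itinerary T X n x} \<inter> space M = (\<Inter>i\<in>{..<n}. ?cell i x)" for x
  proof -
    have "{..<n} \<noteq> {}" using assms by (auto simp: lessThan_empty_iff)
    then have "(\<Inter>i\<in>{..<n}. {y \<in> space M. Q i y}) = {y \<in> space M. \<forall>i<n. Q i y}" for Q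
      by auto
    note this[of "\<lambda>i y. X ((T ^^ i) y) = X ((T ^^ i) x)"]
    moreover have "itinerary T X n -` {itinerary T X n x} \<inter> space M =
        {y \<in> space M. \<forall>i<n. X ((T ^^ i) y) = X ((T ^^ i) x)}"
      by (auto simp only: vimage_def itinerary_eq_iff)
    ultimately show ?thesis by (simp only:)
  qed
  show ?thesis
  proof (rule set_eqI, rule iffI)
    fix D assume "D \<in> iterated_join M T (obs_partition M X) n"
    then obtain f where f: "f \<in> (\<Pi> P\<in>fam ` {..<n}. P)" and D: "D = \<Inter> (f ` fam ` {..<n})" "D \<noteq> {}"
      unfolding iterated_join_def common_refinement fam_def[symmetric] by auto
    then obtain x where x: "x \<in> D" by auto
    have "f (fam i) = ?cell i x" if "i < n" for i
      using f x D(1) that by (intro fam_cell) auto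
    then have "D = (\<Inter>i\<in>{..<n}. ?cell i x)" using D(1) by (auto simp: image_comp)
    moreover have "x \<in> space M"
    proof -
      have "x \<in> ?cell 0 x" using x unfolding calculation by (rule INT_D) (use assms in simp)
      then show ?thesis by simp
    qed
    ultimately show "D \<in> obs_partition M (itinerary T X n)"
      unfolding obs_partition_def fiber[symmetric] by blast
  next
    fix D assume "D \<in> obs_partition M (itinerary T X n)"
    then obtain x where x: "x \<in> space M" and D: "D = (\<Inter>i\<in>{..<n}. ?cell i x)"
      unfolding obs_partition_def using fiber by auto
    \<comment> \<open>The join chooses a cell per partition, not per time, and different times may
      give the same partition. Taking the cell around \<open>x\<close> is consistent in that
      case.\<close>
    define f where "f P = (THE C. C \<in> P \<and> x \<in> C)" for P :: "'a set set"
    have f: "f (fam i) = ?cell i x" for i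
      unfolding f_def
    proof (rule the_equality)
      show "?cell i x \<in> fam i \<and> x \<in> ?cell i x" using cell_fam x by auto
    qed (use fam_cell in blast)
    have "f \<in> (\<Pi> P\<in>fam ` {..<n}. P)" using f cell_fam[OF x] by auto
    moreover have "D = \<Inter> (f ` fam ` {..<n})" using D f by (simp add: image_comp)
    moreover have "x \<in> D" using D x by auto
    ultimately show "D \<in> iterated_join M T (obs_partition M X) n"
      unfolding iterated_join_def common_refinement fam_def[symmetric] by blast
  qed
qed

lemma entropy_wrt_obs_partition:
  assumes "simple_function M X"
  shows "entropy_wrt_partition M T (obs_partition M X) = entropy_rate M T X"
proof -
  have "(\<lambda>n. partition_entropy M (iterated_join M T (obs_partition M X) n) / real n)
      \<longlonglongrightarrow> entropy_rate M T X"
    using entropy_rate_lim[OF assms]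
    by (rule Lim_transform_eventually, intro eventually_sequentiallyI[of 1])
      (simp add: iterated_join_obs_partition partition_entropy_obs_partition)
  then show ?thesis unfolding entropy_wrt_partition_def by (rule limI)
qed

lemma entropy_rate_le_ks_entropy:
  assumes X: "simple_function M X"
  shows "ereal (entropy_rate M T X) \<le> ks_entropy M T"
proof -
  have "finite_measurable_partition M (obs_partition M X)"
    unfolding finite_measurable_partition_def obs_partition_def
    using simple_functionD[OF X] by (auto intro!: partition_onI simp: disjnt_def)
  then show ?thesis
    unfolding ks_entropy_def entropy_wrt_obs_partition[OF X, symmetric] by (auto intro: SUP_upper)
qed

text \<open>Every finite partition is the level-set partition of the map sending a point to its
  cell; hence observables with values in \<open>'a set\<close> suffice.\<close>

lemma ks_entropy_leI:
  assumes "\<And>X :: 'a \<Rightarrow> 'a set. simple_function M X \<Longrightarrow> ereal (entropy_rate M T X) \<le> B"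
  shows "ks_entropy M T \<le> B"
  unfolding ks_entropy_def
proof (rule SUP_least, clarify)
  fix P assume P: "finite_measurable_partition M P"
  then have fin: "finite P" and part: "partition_on (space M) P" and meas: "P \<subseteq> sets M"
    by (auto simp: finite_measurable_partition_def)
  define X where "X x = (THE C. C \<in> P \<and> x \<in> C)" for x
  have X_eq: "X x = C" if "C \<in> P" "x \<in> C" for x C
    unfolding X_def using that part
    by (intro the_equality) (auto simp: partition_on_def disjoint_def)
  have X_in: "X x \<in> P \<and> x \<in> X x" if x: "x \<in> space M" for x
  proof -
    obtain C where "C \<in> P" "x \<in> C" using x part by (auto simp: partition_on_def)
    then show ?thesis using X_eq[of C x] by simp
  qed
  have fib: "X -` {C} \<inter> space M = C" if C: "C \<in> P" for C
  proof
    show "X -` {C} \<inter> space M \<subseteq> C" using X_in by auto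
    have "C \<subseteq> space M" using C meas sets.sets_into_space by auto
    then show "C \<subseteq> X -` {C} \<inter> space M" using X_eq[OF C] by auto
  qed
  have img: "X ` space M = P"
  proof
    show "P \<subseteq> X ` space M"
    proof
      fix C assume C: "C \<in> P"
      then have "C \<noteq> {}" using part by (auto simp: partition_on_def)
      then obtain x where "x \<in> C" by auto
      then have "x \<in> X -` {C} \<inter> space M" using fib[OF C] by simp
      then show "C \<in> X ` space M" by auto
    qed
  qed (use X_in in auto)
  have "simple_function M X"
    unfolding simple_function_def using img fin fib meas by auto
  moreover have "obs_partition M X = P"
    unfolding obs_partition_def img using fib by (simp cong: image_cong)
  ultimately show "ereal (entropy_wrt_partition M T P) \<le> B"
    using assms[of X] entropy_wrt_obs_partition[of X] by simp
qed

end

section \<open>Counting the refinements of a coarse itinerary\<close>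

text \<open>\<open>None\<close> is the common name of all symbols outside \<open>G\<close>, so a
  finite \<open>G\<close> induces a finite partition by the first symbol.\<close>

definition collapse :: "'a set \<Rightarrow> 'a \<Rightarrow> 'a option" where
  "collapse G a = (if a \<in> G then Some a else None)"

text \<open>Only the letters strictly between \<open>a\<close> and \<open>b\<close> are counted, so
  \<open>bridges S a a l\<close> consists of loops with \<open>l + 1\<close> transitions.\<close>

definition bridges :: "('a \<Rightarrow> 'a \<Rightarrow> bool) \<Rightarrow> 'a \<Rightarrow> 'a \<Rightarrow> nat \<Rightarrow> 'a list set" where
  "bridges S a b l = {m. length m = l \<and> successively S (a # m @ [b])}"

text \<open>The \<open>G\<close>-names compatible with the coarse name \<open>y\<close>. Their
  number will bound the entropy that the coarse itinerary leaves undetermined.\<close>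

definition refined_words ::
    "('a \<Rightarrow> 'a \<Rightarrow> bool) \<Rightarrow> 'a set \<Rightarrow> 'a set \<Rightarrow> 'a option list \<Rightarrow> 'a option list set" where
  "refined_words S G F' y = {map (collapse G) w | w. successively S w \<and> map (collapse F') w = y}"

lemma collapse_eq_Some [simp]: "collapse G a = Some b \<longleftrightarrow> a = b \<and> a \<in> G"
  by (auto simp: collapse_def)

lemma Some_eq_collapse [simp]: "Some b = collapse G a \<longleftrightarrow> a = b \<and> a \<in> G"
  by (auto simp: collapse_def)

lemma collapse_in: "collapse G a \<in> insert None (Some ` G)"
  by (auto simp: collapse_def)

lemma finite_collapse_values: "finite G \<Longrightarrow> finite (insert None (Some ` G))"
  by simp

lemma refined_words_subset:
  "refined_words S G F' y \<subseteq> {z. set z \<subseteq> insert None (Some ` G) \<and> length z = length y}"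
  unfolding refined_words_def using collapse_in by fastforce

lemma finite_refined_words: "finite G \<Longrightarrow> finite (refined_words S G F' y)"
  by (rule finite_subset[OF refined_words_subset finite_lists_length_eq]) auto

text \<open>The crude count, for stretches of a word that are not enclosed between two visits to
  \<open>F\<close>.\<close>

lemma card_refined_words_le:
  assumes "finite G"
  shows "real (card (refined_words S G F' y)) \<le> exp (ln (real (card G + 1)) * real (length y))"
proof -
  have "card (insert None (Some ` G)) = card G + 1"
    using assms by (simp add: card_image)
  then have "card (refined_words S G F' y) \<le> (card G + 1) ^ length y"
    using card_mono[OF finite_lists_length_eq[of "insert None (Some ` G)"] refined_words_subset[of S G F' y]] assms
    by (simp add: card_lists_length_eq)
  then have "real (card (refined_words S G F' y)) \<le> real (card G + 1) ^ length y"
    using of_nat_mono by fastforce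
  also have "\<dots> = exp (ln (real (card G + 1)) * real (length y))"
    by (simp add: exp_of_nat2_mult)
  finally show ?thesis .
qed

text \<open>Cutting a word forgets the transition across the cut, so it can only enlarge the set of
  pairs of pieces.\<close>

lemma card_refined_words_append:
  assumes G: "finite G"
  shows "card (refined_words S G F' (u @ v)) \<le>
    card (refined_words S G F' u) * card (refined_words S G F' v)"
proof -
  let ?R = "refined_words S G F'"
  have "?R (u @ v) \<subseteq> (\<lambda>(p, q). p @ q) ` (?R u \<times> ?R v)"
  proof
    fix z assume "z \<in> ?R (u @ v)"
    then obtain w where w: "successively S w" "map (collapse F') w = u @ v" "z = map (collapse G) w"
      by (auto simp: refined_words_def)
    from w(2) obtain p q where pq: "w = p @ q" "map (collapse F') p = u" "map (collapse F') q = v"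
      by (auto simp: map_eq_append_conv)
    with w have "map (collapse G) p \<in> ?R u" "map (collapse G) q \<in> ?R v"
      by (auto simp: refined_words_def successively_append_iff)
    then show "z \<in> (\<lambda>(p, q). p @ q) ` (?R u \<times> ?R v)" using w pq by force
  qed
  then have "card (?R (u @ v)) \<le> card (?R u \<times> ?R v)"
    using G by (intro surj_card_le) (auto simp: finite_refined_words)
  then show ?thesis by (simp add: card_cartesian_product)
qed

text \<open>A cut at a visible symbol keeps that symbol in both pieces, so both excursions retain
  the constraint at their end point.\<close>

lemma card_refined_words_glue:
  assumes G: "finite G"
  shows "card (refined_words S G F' (u @ Some b # r)) \<le>
    card (refined_words S G F' (u @ [Some b])) * card (refined_words S G F' (Some b # r))"
proof -
  let ?R = "refined_words S G F'"
  \<comment> \<open>\<open>butlast\<close> removes the copy of the cut symbol that the two pieces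
    share.\<close>
  have "?R (u @ Some b # r) \<subseteq> (\<lambda>(p, q). butlast p @ q) ` (?R (u @ [Some b]) \<times> ?R (Some b # r))"
  proof
    fix z assume "z \<in> ?R (u @ Some b # r)"
    then obtain w where w: "successively S w" "map (collapse F') w = u @ Some b # r"
        "z = map (collapse G) w"
      by (auto simp: refined_words_def)
    from w(2) obtain p q where pq: "w = p @ b # q" "map (collapse F') p = u"
        "map (collapse F') q = r" "b \<in> F'"
      unfolding map_eq_append_conv map_eq_Cons_conv by auto
    with w have "map (collapse G) (p @ [b]) \<in> ?R (u @ [Some b])"
      unfolding refined_words_def by (auto simp: successively_append_iff intro!: exI[of _ "p @ [b]"])
    moreover from pq w have "map (collapse G) (b # q) \<in> ?R (Some b # r)"
      unfolding refined_words_def by (auto simp: successively_append_iff intro!: exI[of _ "b # q"])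
    ultimately show "z \<in> (\<lambda>(p, q). butlast p @ q) ` (?R (u @ [Some b]) \<times> ?R (Some b # r))"
      using w pq
      by (intro image_eqI[of _ _ "(map (collapse G) (p @ [b]), map (collapse G) (b # q))"]) auto
  qed
  then have "card (?R (u @ Some b # r)) \<le> card (?R (u @ [Some b]) \<times> ?R (Some b # r))"
    using G by (intro surj_card_le) (auto simp: finite_refined_words)
  then show ?thesis by (simp add: card_cartesian_product)
qed

text \<open>\<open>F'\<close> contains every symbol of an excursion of length at most \<open>L\<close> out of \<open>F\<close>. Excursions
  that are invisible to \<open>F'\<close> are therefore long, so that the additive constant \<open>\<beta>\<close> in the number of
  bridges costs at most one unit per symbol.\<close>

locale bridge_bound =
  fixes S :: "'a \<Rightarrow> 'a \<Rightarrow> bool" and F F' G :: "'a set" and c \<beta> :: real and L :: nat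
  assumes FF': "F \<subseteq> F'" and F'G: "F' \<subseteq> G" and G: "finite G"
    and c_nonneg: "0 \<le> c" and \<beta>_le: "\<beta> \<le> real L"
    and finite_bridges: "\<And>a b l. a \<in> F \<Longrightarrow> b \<in> F \<Longrightarrow> finite (bridges S a b l)"
    and card_bridges: "\<And>a b l. a \<in> F \<Longrightarrow> b \<in> F \<Longrightarrow>
      real (card (bridges S a b l)) \<le> exp (\<beta> + c * real l)"
    and short_bridges: "\<And>a b l m. a \<in> F \<Longrightarrow> b \<in> F \<Longrightarrow> l \<le> L \<Longrightarrow> m \<in> bridges S a b l \<Longrightarrow> set m \<subseteq> F'"
begin

abbreviation "off_F y \<equiv> y \<notin> Some ` F"

lemma card_refined_words_bridge:
  assumes ab: "a \<in> F" "b \<in> F"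
  shows "real (card (refined_words S G F' (Some a # m @ [Some b]))) \<le> exp ((c + 1) * real (length m))"
proof -
  let ?R = "refined_words S G F' (Some a # m @ [Some b])"
  let ?f = "\<lambda>m'. map (collapse G) (a # m' @ [b])"
  let ?B = "{m' \<in> bridges S a b (length m). map (collapse F') m' = m}"
  have sub: "?R \<subseteq> ?f ` ?B"
  proof
    fix z assume "z \<in> ?R"
    then obtain w where w: "successively S w" "map (collapse F') w = Some a # m @ [Some b]"
        "z = map (collapse G) w"
      by (auto simp: refined_words_def)
    from w(2) obtain m' where m': "w = a # m' @ [b]" "map (collapse F') m' = m"
      by (auto simp: map_eq_append_conv map_eq_Cons_conv)
    then have "m' \<in> ?B" using w(1) by (auto simp: bridges_def)
    then show "z \<in> ?f ` ?B" using w(3) m'(1) by auto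
  qed
  have finB: "finite ?B" using finite_bridges[OF ab] by auto
  have card: "card ?R \<le> card ?B" using sub by (rule surj_card_le[OF finB])
  show ?thesis
  proof (cases "length m \<le> L")
    case True
    \<comment> \<open>A short bridge is written entirely in \<open>F'\<close>, where
      \<open>collapse F'\<close> loses nothing; the coarse name then leaves no choice.\<close>
    have "m' = map the m" if "m' \<in> ?B" for m'
    proof -
      have "set m' \<subseteq> F'" using short_bridges[OF ab True] that by auto
      then have "map (the \<circ> collapse F') m' = m'" by (intro map_idI) (auto simp: collapse_def)
      then show ?thesis using that by auto
    qed
    then have "card ?B \<le> card {map the m}" by (intro card_mono) auto
    then have "real (card ?R) \<le> 1" using card by simp
    also have "1 \<le> exp ((c + 1) * real (length m))" using c_nonneg by simp
    finally show ?thesis .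
  next
    case False
    have "card ?B \<le> card (bridges S a b (length m))"
      using finite_bridges[OF ab] by (intro card_mono) auto
    then have "real (card ?R) \<le> real (card (bridges S a b (length m)))" using card by linarith
    also have "\<dots> \<le> exp (\<beta> + c * real (length m))" by (rule card_bridges[OF ab])
    also have "\<dots> \<le> exp ((c + 1) * real (length m))"
    proof -
      have "\<beta> \<le> real (length m)" using \<beta>_le False by linarith
      then show ?thesis by (simp add: algebra_simps)
    qed
    finally show ?thesis .
  qed
qed

text \<open>Cut at the next visit to \<open>F\<close> and induct. The letters between two
  consecutive visits are exactly the \<open>off_F\<close> letters of that piece, so the exponents
  add up without a cost per excursion.\<close>

lemma card_refined_words_anchored:
  assumes "y \<noteq> []" "hd y \<in> Some ` F" "last y \<in> Some ` F"
  shows "real (card (refined_words S G F' y)) \<le> exp ((c + 1) * real (length (filter off_F y)))"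
  using assms
proof (induction "length y" arbitrary: y rule: less_induct)
  case less
  then obtain a y' where y: "y = Some a # y'" and a: "a \<in> F" by (cases y) auto
  show ?case
  proof (cases "y' = []")
    case True
    have "refined_words S G F' [Some a] \<subseteq> {[Some a]}"
      using F'G by (auto simp: refined_words_def map_eq_Cons_conv)
    from card_mono[OF _ this] show ?thesis using y True a by simp
  next
    case False
    then have "\<exists>x\<in>set y'. x \<in> Some ` F"
      using less.prems(3) y last_in_set[OF False] False by (metis last_ConsR)
    then obtain m x r where y': "y' = m @ x # r" and "x \<in> Some ` F"
        and m: "\<forall>z\<in>set m. off_F z"
      by (rule split_list_first_propE)
    then obtain b where b: "x = Some b" "b \<in> F" by auto
    have "real (card (refined_words S G F' y)) \<le>
        real (card (refined_words S G F' (Some a # m @ [Some b])) * card (refined_words S G F' (Some b # r)))"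
      using card_refined_words_glue[OF G, of S F' "Some a # m" b r] y y' b
      by (intro of_nat_mono) simp
    also have "\<dots> \<le> exp ((c + 1) * real (length m)) * exp ((c + 1) * real (length (filter off_F (Some b # r))))"
      unfolding of_nat_mult
    proof (intro mult_mono card_refined_words_bridge a b less.hyps)
      show "last (Some b # r) \<in> Some ` F" using less.prems(3) y y' b by auto
    qed (use y y' b in auto)
    also have "\<dots> = exp ((c + 1) * real (length (filter off_F y)))"
      using y y' a b m by (simp add: exp_add[symmetric] algebra_simps filter_id_conv[THEN iffD2])
    finally show ?thesis .
  qed
qed

text \<open>Between the first and the last visit to \<open>F\<close> the word is anchored. The
  stretches before and after belong to unfinished excursions, about which \<open>bridges\<close>
  says nothing, and get the crude rate.\<close>

lemma card_refined_words_boundary: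
  "real (card (refined_words S G F' y)) \<le> exp ((c + 1) * real (length (filter off_F y)) +
     ln (real (card G + 1)) *
       (real (length (takeWhile off_F y)) + real (length (takeWhile off_F (rev y)))))"
proof (cases "\<exists>x\<in>set y. x \<in> Some ` F")
  case False
  then have eq: "takeWhile off_F y = y" "takeWhile off_F (rev y) = rev y"
    by (auto simp: takeWhile_eq_all_conv)
  have "real (card (refined_words S G F' y)) \<le> exp (ln (real (card G + 1)) * real (length y))"
    by (rule card_refined_words_le[OF G])
  \<comment> \<open>Without a visit to \<open>F\<close> both boundary stretches are the whole word;
    counting it twice only weakens the bound.\<close>
  also have "\<dots> \<le> exp ((c + 1) * real (length (filter off_F y)) +
      ln (real (card G + 1)) * (real (length y) + real (length y)))"
    using c_nonneg by (simp add: distrib_left add_nonneg_nonneg)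
  finally show ?thesis unfolding eq by simp
next
  case True
  then obtain u x r where y: "y = u @ x # r" and x: "x \<in> Some ` F" and u: "\<forall>z\<in>set u. off_F z"
    by (rule split_list_first_propE)
  \<comment> \<open>The last visit is sought in the tail that starts at the first one, so that a
    single visit, being both, is covered.\<close>
  have "\<exists>z\<in>set (x # r). z \<in> Some ` F" using x by auto
  then obtain p x' v where xr: "x # r = p @ x' # v" and x': "x' \<in> Some ` F"
      and v: "\<forall>z\<in>set v. off_F z"
    by (rule split_list_last_propE)
  define mid where "mid = p @ [x']"
  have y_eq: "y = u @ mid @ v" using y xr by (simp add: mid_def)
  have mid: "mid \<noteq> []" "last mid \<in> Some ` F" using x' by (auto simp: mid_def)
  have "hd mid = x" using xr by (cases p) (auto simp: mid_def)
  then have hd: "hd mid \<in> Some ` F" using x by simp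
  have tw1: "takeWhile off_F y = u"
    using y x u by (simp add: takeWhile_append)
  have "rev y = rev v @ x' # rev p @ rev u" by (simp add: y_eq mid_def)
  then have tw2: "takeWhile off_F (rev y) = rev v"
    using x' v by (simp add: takeWhile_append)
  have "real (card (refined_words S G F' y)) \<le>
      real (card (refined_words S G F' u) * (card (refined_words S G F' mid) * card (refined_words S G F' v)))"
    unfolding y_eq
    by (intro of_nat_mono order_trans[OF card_refined_words_append[OF G]] mult_left_mono) (simp_all add: card_refined_words_append[OF G])
  also have "\<dots> \<le> exp (ln (real (card G + 1)) * real (length u)) *
      (exp ((c + 1) * real (length (filter off_F mid))) * exp (ln (real (card G + 1)) * real (length v)))"
    unfolding of_nat_mult
    by (intro mult_mono card_refined_words_le G card_refined_words_anchored mid hd) auto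
  also have "\<dots> = exp ((c + 1) * real (length (filter off_F mid)) +
      ln (real (card G + 1)) * (real (length u) + real (length v)))"
    by (simp add: exp_add[symmetric] algebra_simps)
  also have "\<dots> \<le> exp ((c + 1) * real (length (filter off_F y)) +
      ln (real (card G + 1)) * (real (length u) + real (length v)))"
    using c_nonneg by (simp add: y_eq mult_left_mono)
  finally show ?thesis unfolding tw1 tw2 by simp
qed

end

section \<open>Symbol partitions generate\<close>

lemma cylinder_subset: "cylinder S w \<subseteq> markov_shift S"
  by (auto simp: cylinder_def)

lemma openin_cylinder: "openin (shift_topology S) (cylinder S w)"
  unfolding shift_topology_def by (rule topology_generated_by_Basis) auto

lemma mem_prefix_cylinder: "x \<in> markov_shift S \<Longrightarrow> x \<in> cylinder S (map x [0..<n])"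
  by (auto simp: cylinder_def)

text \<open>Longer prefixes give smaller cylinders, so cylinders form a base of the topology and not
  just a subbase.\<close>

lemma openin_shift_topology_prefix:
  assumes "openin (shift_topology S) U" "x \<in> U"
  shows "\<exists>n. cylinder S (map x [0..<n]) \<subseteq> U"
proof -
  have "generate_topology_on (range (cylinder S)) U"
    using assms(1) by (simp add: shift_topology_def openin_topology_generated_by_iff)
  then show ?thesis using assms(2)
  proof induction
    case (Int a b)
    then obtain m n where "cylinder S (map x [0..<m]) \<subseteq> a" "cylinder S (map x [0..<n]) \<subseteq> b" by auto
    moreover have "cylinder S (map x [0..<max m n]) \<subseteq> cylinder S (map x [0..<m]) \<inter> cylinder S (map x [0..<n])"
      by (auto simp: cylinder_def)
    ultimately show ?case by (intro exI[of _ "max m n"]) blast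
  next
    case (UN K)
    then obtain k where "k \<in> K" "x \<in> k" by auto
    with UN(2) obtain n where "cylinder S (map x [0..<n]) \<subseteq> k" by auto
    with \<open>k \<in> K\<close> show ?case by (intro exI[of _ n]) auto
  next
    case (Basis s)
    then obtain w where w: "s = cylinder S w" by auto
    have "cylinder S (map x [0..<length w]) \<subseteq> s" using Basis(2) by (auto simp: w cylinder_def)
    then show ?case ..
  qed simp
qed

lemma continuous_map_shift_topologyI:
  fixes f :: "(nat \<Rightarrow> 'a) \<Rightarrow> real"
  assumes "\<And>x e. x \<in> markov_shift S \<Longrightarrow> 0 < e \<Longrightarrow>
    \<exists>n. \<forall>y\<in>markov_shift S. (\<forall>i<n. y i = x i) \<longrightarrow> \<bar>f y - f x\<bar> < e"
  shows "continuous_map (shift_topology S) euclideanreal f"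
  unfolding continuous_map_def
proof (intro conjI allI impI)
  fix U :: "real set" assume "openin euclideanreal U"
  then have U: "open U" by simp
  show "openin (shift_topology S) {x \<in> topspace (shift_topology S). f x \<in> U}"
  proof (subst openin_subopen, intro ballI)
    fix x assume "x \<in> {x \<in> topspace (shift_topology S). f x \<in> U}"
    then have x: "x \<in> markov_shift S" "f x \<in> U" by (auto simp: topspace_shift_topology)
    obtain e where e: "e > 0" "\<And>t. \<bar>t - f x\<bar> < e \<Longrightarrow> t \<in> U"
      using U x(2) unfolding open_dist by (auto simp: dist_real_def)
    obtain n where n: "\<And>y. y \<in> markov_shift S \<Longrightarrow> (\<forall>i<n. y i = x i) \<Longrightarrow> \<bar>f y - f x\<bar> < e"
      using assms[OF x(1) e(1)] by auto
    show "\<exists>V. openin (shift_topology S) V \<and> x \<in> V \<and> V \<subseteq> {x \<in> topspace (shift_topology S). f x \<in> U}"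
    proof (intro exI conjI)
      show "cylinder S (map x [0..<n]) \<subseteq> {x \<in> topspace (shift_topology S). f x \<in> U}"
        using n e(2) by (auto simp: cylinder_def topspace_shift_topology)
    qed (use x in \<open>auto intro: openin_cylinder mem_prefix_cylinder\<close>)
  qed
qed auto

text \<open>There are only countably many words over a countable alphabet, so every open set is a
  countable union of cylinders.\<close>

lemma sets_shift_borel_cylinders:
  fixes S :: "'a::countable \<Rightarrow> 'a \<Rightarrow> bool"
  shows "sets (shift_borel S) = sigma_sets (markov_shift S) (range (cylinder S))"
  unfolding sets_shift_borel
proof (rule sigma_sets_eqI)
  fix U assume "U \<in> {U. openin (shift_topology S) U}"
  then have U: "openin (shift_topology S) U" by simp
  have "U = (\<Union>w\<in>{w. cylinder S w \<subseteq> U}. cylinder S w)"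
  proof (intro equalityI subsetI)
    fix x assume x: "x \<in> U"
    then have "x \<in> markov_shift S" using openin_subset[OF U] topspace_shift_topology by auto
    then show "x \<in> (\<Union>w\<in>{w. cylinder S w \<subseteq> U}. cylinder S w)"
      using openin_shift_topology_prefix[OF U x] mem_prefix_cylinder by blast
  qed auto
  also have "\<dots> \<in> sigma_sets (markov_shift S) (range (cylinder S))"
    by (rule sigma_sets_UNION) auto
  finally show "U \<in> sigma_sets (markov_shift S) (range (cylinder S))" .
qed (auto intro: openin_cylinder)

lemma left_shift_in_markov_shift: "x \<in> markov_shift S \<Longrightarrow> left_shift x \<in> markov_shift S"
  by (simp add: markov_shift_def left_shift_def)

lemma funpow_left_shift: "(left_shift ^^ n) x = (\<lambda>i. x (n + i))"
  by (induction n arbitrary: x) (auto simp: left_shift_def funpow_swap1)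

lemma measurable_left_shift:
  fixes S :: "'a::countable \<Rightarrow> 'a \<Rightarrow> bool"
  shows "left_shift \<in> measurable (shift_borel S) (shift_borel S)"
proof (rule measurable_sigma_sets[OF sets_shift_borel_cylinders])
  show "range (cylinder S) \<subseteq> Pow (markov_shift S)" using cylinder_subset by auto
  show "left_shift \<in> space (shift_borel S) \<rightarrow> markov_shift S"
    using left_shift_in_markov_shift by (auto simp: space_shift_borel)
next
  fix y assume "y \<in> range (cylinder S)"
  then obtain w where w: "y = cylinder S w" by auto
  have "left_shift -` y \<inter> space (shift_borel S) = (\<Union>a. cylinder S (a # w))"
    by (auto simp: w cylinder_def left_shift_def space_shift_borel markov_shift_def less_Suc_eq_0_disj)
  also have "\<dots> \<in> sets (shift_borel S)"
    unfolding sets_shift_borel_cylinders by (intro sigma_sets_UNION) auto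
  finally show "left_shift -` y \<inter> space (shift_borel S) \<in> sets (shift_borel S)" .
qed

text \<open>The sets that can be approximated in measure contain the algebra and are closed under
  complements and countable unions; a union is first truncated to finitely many members.\<close>

lemma (in finite_measure) algebra_approximation:
  assumes \<A>: "algebra (space M) \<A>" "\<A> \<subseteq> sets M" and gen: "sets M = sigma_sets (space M) \<A>"
    and "B \<in> sets M" "0 < e"
  shows "\<exists>A\<in>\<A>. measure M ((A - B) \<union> (B - A)) < e"
proof -
  interpret \<A>: algebra "space M" \<A> by fact
  have "B \<in> sigma_sets (space M) \<A>" using assms by simp
  then show ?thesis using \<open>0 < e\<close>
  proof (induction arbitrary: e)
    case (Basic a)
    then show ?case by (intro bexI[of _ a]) auto
  next
    case Empty
    then show ?case by (intro bexI[of _ "{}"]) auto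
  next
    case (Compl a)
    then obtain A where A: "A \<in> \<A>" "measure M ((A - a) \<union> (a - A)) < e" by blast
    have "(space M - A) - (space M - a) \<union> ((space M - a) - (space M - A)) = (A - a) \<union> (a - A)"
      using A(1) \<A>.space_closed sigma_sets_into_sp[OF \<A>.space_closed Compl(1)] by auto
    then show ?case using A by (intro bexI[of _ "space M - A"]) auto
  next
    case (Union B)
    have B: "B i \<in> sets M" for i using Union(1) gen by simp
    let ?U = "\<lambda>n. \<Union>i<n. B i"
    have "(\<lambda>n. measure M (?U n)) \<longlonglongrightarrow> measure M (\<Union>n. ?U n)"
      using B by (intro finite_Lim_measure_incseq) (auto simp: incseq_def intro: less_le_trans)
    moreover have "(\<Union>n. ?U n) = (\<Union>i. B i)" by auto
    ultimately have "\<forall>\<^sub>F n in sequentially. measure M (\<Union>i. B i) - e / 2 < measure M (?U n)"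
      using Union(3) by (intro order_tendstoD(1)) auto
    then obtain n where n: "measure M (\<Union>i. B i) - e / 2 < measure M (?U n)"
      using eventually_happens sequentially_bot by blast
    \<comment> \<open>Half of \<open>e\<close> pays for the truncation, the other half for the
      \<open>n\<close> approximations; \<open>Suc n\<close> avoids a division by zero.\<close>
    have "\<exists>A\<in>\<A>. measure M ((A - B i) \<union> (B i - A)) < e / (2 * real (Suc n))" for i
      using Union(3) by (intro Union(2)) auto
    then obtain A where A: "\<And>i. A i \<in> \<A>"
        "\<And>i. measure M ((A i - B i) \<union> (B i - A i)) < e / (2 * real (Suc n))"
      by metis
    have Am: "A i \<in> sets M" for i using A(1) \<A>(2) by auto
    let ?A = "\<Union>i<n. A i"
    let ?E = "\<Union>i<n. (A i - B i) \<union> (B i - A i)"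
    have "measure M ((?A - (\<Union>i. B i)) \<union> ((\<Union>i. B i) - ?A))
        \<le> measure M (((\<Union>i. B i) - ?U n) \<union> ?E)"
      using B Am by (intro finite_measure_mono) auto
    also have "\<dots> \<le> measure M ((\<Union>i. B i) - ?U n) + measure M ?E"
      using B Am by (intro measure_Un_le) auto
    also have "measure M ((\<Union>i. B i) - ?U n) < e / 2"
      using n B by (subst finite_measure_Diff) auto
    also have "measure M ?E \<le> (\<Sum>i<n. measure M ((A i - B i) \<union> (B i - A i)))"
      using B Am by (intro finite_measure_subadditive_finite) auto
    also have "\<dots> \<le> (\<Sum>i<n. e / (2 * real (Suc n)))"
      using A(2) by (intro sum_mono less_imp_le)
    also have "\<dots> \<le> e / 2" using Union(3) by (simp add: field_simps)
    finally have "measure M ((?A - (\<Union>i. B i)) \<union> ((\<Union>i. B i) - ?A)) < e" by simp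
    moreover have "?A \<in> \<A>" using A(1) by auto
    ultimately show ?case by blast
  qed
qed

lemma simple_function_membership_vector:
  assumes "finite V" "\<And>v. v \<in> V \<Longrightarrow> C v \<in> sets M"
  shows "simple_function M (\<lambda>x. {v \<in> V. x \<in> C v})"
  using assms
proof (induction V)
  case (insert w V)
  have "simple_function M (\<lambda>x. x \<in> C w)"
    unfolding simple_function_def
  proof (intro conjI ballI)
    fix b
    have "(\<lambda>x. x \<in> C w) -` {b} \<inter> space M = (if b then C w \<inter> space M else space M - C w)"
      by auto
    then show "(\<lambda>x. x \<in> C w) -` {b} \<inter> space M \<in> sets M" using insert.prems[of w] by auto
  qed simp
  from simple_function_compose2[OF this insert.IH, of "\<lambda>b u. if b then insert w u else u"]
  have "simple_function M (\<lambda>x. if x \<in> C w then insert w {v \<in> V. x \<in> C v} else {v \<in> V. x \<in> C v})"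
    using insert.prems by simp
  then show ?case
    by (rule simple_function_cong[THEN iffD1, rotated]) auto
qed simp

section \<open>Invariant measures on the shift and sets determined by finite names\<close>

locale markov_measure =
  fixes S :: "'a::countable \<Rightarrow> 'a \<Rightarrow> bool" and M
  assumes invariant: "M \<in> invariant_measures S"

sublocale markov_measure \<subseteq> measure_preserving_map M left_shift
proof -
  have *: "prob_space M" "sets M = sets (shift_borel S)"
    "\<And>B. B \<in> sets M \<Longrightarrow> emeasure M (left_shift -` B \<inter> space M) = emeasure M B"
    using invariant by (auto simp: invariant_measures_def)
  interpret prob_space M by fact
  show "measure_preserving_map M left_shift"
    by unfold_locales
      (use *(3) measurable_left_shift[of S] in \<open>auto simp: measurable_cong_sets[OF *(2) *(2)]\<close>)
qed

context markov_measure
begin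

lemma sets_eq: "sets M = sets (shift_borel S)"
  using invariant by (auto simp: invariant_measures_def)

lemma space_eq: "space M = markov_shift S"
  using sets_eq_imp_space_eq[OF sets_eq] by (simp add: space_shift_borel)

lemma cylinder_in_sets: "cylinder S w \<in> sets M"
  unfolding sets_eq sets_shift_borel_cylinders by auto

lemma symbol_set_in_sets: "{x \<in> space M. x i \<in> A} \<in> sets M"
proof -
  have "(\<Union>a\<in>A. cylinder S [a]) \<in> sets M"
    by (intro sets.countable_UN') (auto intro: cylinder_in_sets)
  then have "(left_shift ^^ i) -` (\<Union>a\<in>A. cylinder S [a]) \<inter> space M \<in> sets M"
    by (rule measurable_sets[OF funpow_measurable])
  also have "(left_shift ^^ i) -` (\<Union>a\<in>A. cylinder S [a]) \<inter> space M = {x \<in> space M. x i \<in> A}"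
    using funpow_space[of _ i] by (auto simp: cylinder_def funpow_left_shift space_eq)
  finally show ?thesis .
qed

end

definition symbol_name :: "'a set \<Rightarrow> (nat \<Rightarrow> 'a) \<Rightarrow> 'a option" where
  "symbol_name G x = collapse G (x 0)"

lemma itinerary_symbol_name:
  "itinerary left_shift (symbol_name G) n x = map (collapse G) (map x [0..<n])"
  by (rule nth_equalityI) (auto simp: symbol_name_def funpow_left_shift)

lemma (in markov_measure) simple_function_symbol_name:
  assumes "finite G"
  shows "simple_function M (symbol_name G)"
  unfolding simple_function_def
proof (intro conjI ballI)
  show "finite (symbol_name G ` space M)"
    by (rule finite_subset[OF _ finite_collapse_values[OF assms]])
      (auto simp: symbol_name_def collapse_def)
  fix v
  have "symbol_name G -` {v} \<inter> space M = {x \<in> space M. x 0 \<in> {a. collapse G a = v}}"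
    by (auto simp: symbol_name_def)
  then show "symbol_name G -` {v} \<inter> space M \<in> sets M" using symbol_set_in_sets by (simp only:)
qed

context markov_measure
begin

definition name_determined :: "'a set \<Rightarrow> nat \<Rightarrow> (nat \<Rightarrow> 'a) set \<Rightarrow> bool" where
  "name_determined G k A \<longleftrightarrow> A \<subseteq> space M \<and> (\<forall>x\<in>A. \<forall>y\<in>space M.
     itinerary left_shift (symbol_name G) k x = itinerary left_shift (symbol_name G) k y \<longrightarrow> y \<in> A)"

text \<open>Over an infinite alphabet finite unions of cylinders need not be closed under
  complement. Sets determined by finitely many coordinates, each read through a finite
  \<open>G\<close>, do form an algebra, and it contains all cylinders.\<close>

definition name_sets :: "(nat \<Rightarrow> 'a) set set" where
  "name_sets = {A. \<exists>G k. finite G \<and> name_determined G k A}"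

lemma itinerary_symbol_name_mono:
  assumes "G \<subseteq> G'" "k \<le> k'"
    and eq: "itinerary left_shift (symbol_name G') k' x = itinerary left_shift (symbol_name G') k' y"
  shows "itinerary left_shift (symbol_name G) k x = itinerary left_shift (symbol_name G) k y"
proof -
  have "collapse G (x i) = collapse G (y i)" if "i < k" for i
  proof -
    have "collapse G' (x i) = collapse G' (y i)"
      using eq that \<open>k \<le> k'\<close> by (simp add: itinerary_eq_iff symbol_name_def funpow_left_shift)
    then show ?thesis using \<open>G \<subseteq> G'\<close> by (auto simp: collapse_def split: if_splits)
  qed
  then show ?thesis by (simp add: itinerary_eq_iff symbol_name_def funpow_left_shift)
qed

lemma name_determined_mono:
  assumes "name_determined G k A" "G \<subseteq> G'" "k \<le> k'"
  shows "name_determined G' k' A"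
  using assms(1) itinerary_symbol_name_mono[OF assms(2,3)] unfolding name_determined_def by meson

lemma name_determined_Diff:
  assumes "name_determined G k A"
  shows "name_determined G k (space M - A)"
  unfolding name_determined_def
proof (intro conjI ballI impI)
  fix x y assume "x \<in> space M - A" "y \<in> space M"
    "itinerary left_shift (symbol_name G) k x = itinerary left_shift (symbol_name G) k y"
  then show "y \<in> space M - A" using assms unfolding name_determined_def by auto
qed auto

lemma name_determined_Un:
  "name_determined G k A \<Longrightarrow> name_determined G k B \<Longrightarrow> name_determined G k (A \<union> B)"
  unfolding name_determined_def by auto

lemma name_sets_subset: "name_sets \<subseteq> sets M"
proof
  fix A assume "A \<in> name_sets"
  then obtain G k where G: "finite G" and A: "name_determined G k A"
    unfolding name_sets_def by auto
  let ?I = "itinerary left_shift (symbol_name G) k"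
  have "A = ?I -` (?I ` A) \<inter> space M" using A unfolding name_determined_def by fastforce
  also have "\<dots> \<in> sets M"
    by (intro simple_functionD(2) simple_function_itinerary simple_function_symbol_name G)
  finally show "A \<in> sets M" .
qed

lemma algebra_name_sets: "algebra (space M) name_sets"
proof (rule algebra_iff_Un[THEN iffD2], intro conjI ballI)
  show "name_sets \<subseteq> Pow (space M)" by (auto simp: name_sets_def name_determined_def)
  show "{} \<in> name_sets" by (auto simp: name_sets_def name_determined_def)
next
  fix A assume "A \<in> name_sets"
  then obtain G k where "finite G" "name_determined G k A" unfolding name_sets_def by auto
  then have "finite G \<and> name_determined G k (space M - A)" by (simp add: name_determined_Diff)
  then show "space M - A \<in> name_sets" unfolding name_sets_def by blast
next
  fix A B assume "A \<in> name_sets" "B \<in> name_sets"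
  then obtain G k G' k' where fin: "finite G" "finite G'"
    and A: "name_determined G k A" and B: "name_determined G' k' B"
    unfolding name_sets_def by auto
  have "name_determined (G \<union> G') (max k k') (A \<union> B)"
    by (intro name_determined_Un name_determined_mono[OF A] name_determined_mono[OF B]) auto
  then show "A \<union> B \<in> name_sets" unfolding name_sets_def using fin by blast
qed

lemma cylinder_in_name_sets: "cylinder S w \<in> name_sets"
proof -
  have "name_determined (set w) (length w) (cylinder S w)"
    unfolding name_determined_def
  proof (intro conjI ballI impI)
    fix x y assume x: "x \<in> cylinder S w" and y: "y \<in> space M"
      and eq: "itinerary left_shift (symbol_name (set w)) (length w) x =
        itinerary left_shift (symbol_name (set w)) (length w) y"
    have "y i = w ! i" if i: "i < length w" for i
    proof -
      have "x i = w ! i" using x i by (simp add: cylinder_def)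
      moreover have "collapse (set w) (x i) = collapse (set w) (y i)"
        using eq i by (simp add: itinerary_eq_iff symbol_name_def funpow_left_shift)
      ultimately show ?thesis using i by (auto simp: collapse_def split: if_splits)
    qed
    then show "y \<in> cylinder S w" using y by (simp add: cylinder_def space_eq)
  qed (use cylinder_subset space_eq in blast)
  then show ?thesis unfolding name_sets_def by blast
qed

lemma sets_eq_sigma_name_sets: "sets M = sigma_sets (space M) name_sets"
proof
  show "sets M \<subseteq> sigma_sets (space M) name_sets"
    unfolding sets_eq sets_shift_borel_cylinders space_eq
    by (rule sigma_sets_mono') (use cylinder_in_name_sets in auto)
  show "sigma_sets (space M) name_sets \<subseteq> sets M"
    using name_sets_subset by (rule sets.sigma_sets_subset)
qed

text \<open>Let \<open>D\<close> record the symmetric differences between the cells of \<open>X\<close> and approximating sets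
  determined by finitely many symbols. Then \<open>X\<close> is a function of \<open>D\<close> and those symbols, and \<open>D\<close> is
  almost constant, so it has small entropy.\<close>

lemma entropy_rate_le_of_symbol_names:
  assumes "finite F"
    and le: "\<And>G. finite G \<Longrightarrow> F \<subseteq> G \<Longrightarrow> entropy_rate M left_shift (symbol_name G) \<le> B"
    and X: "simple_function M X"
  shows "entropy_rate M left_shift X \<le> B"
proof -
  let ?V = "X ` space M"
  let ?N = "real (card ?V)"
  \<comment> \<open>The dominant value bound for \<open>D\<close> at the value \<open>{}\<close>: at
    most \<open>?N\<close> error sets of measure below \<open>e\<close> have total mass at most
    \<open>?N * e\<close>, and \<open>D\<close> takes values in \<open>Pow ?V\<close>.\<close>
  let ?err = "\<lambda>e. ?N * e + real (card (Pow ?V)) * (2 * sqrt (?N * e))"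
  have finV: "finite ?V" using simple_functionD(1)[OF X] .
  have bound: "entropy_rate M left_shift X \<le> ?err e + B" if e: "0 < e" for e
  proof -
    let ?C = "\<lambda>v. X -` {v} \<inter> space M"
    have "\<exists>A\<in>name_sets. measure M ((A - ?C v) \<union> (?C v - A)) < e" for v
      by (rule algebra_approximation[OF algebra_name_sets name_sets_subset sets_eq_sigma_name_sets
            simple_functionD(2)[OF X] e])
    then obtain A where A: "\<And>v. A v \<in> name_sets"
        and A_close: "\<And>v. measure M ((A v - ?C v) \<union> (?C v - A v)) < e"
      by metis
    have "\<exists>G k. finite G \<and> name_determined G k (A v)" for v
      using A[of v] by (simp add: name_sets_def)
    then obtain G' k' where fin: "\<And>v. finite (G' v)" and det: "\<And>v. name_determined (G' v) (k' v) (A v)"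
      by metis
    define G where "G = F \<union> (\<Union>v\<in>?V. G' v)"
    define k where "k = (\<Sum>v\<in>?V. k' v)"
    have finG: "finite G" 
      unfolding G_def using finV fin \<open>finite F\<close> by (intro finite_UnI finite_UN_I)
    have det': "name_determined G k (A v)" if v: "v \<in> ?V" for v
    proof (rule name_determined_mono[OF det])
      show "G' v \<subseteq> G" using v by (auto simp: G_def)
      show "k' v \<le> k" unfolding k_def using finV v by (intro member_le_sum) auto
    qed
    let ?E = "\<lambda>v. (A v - ?C v) \<union> (?C v - A v)"
    have E: "?E v \<in> sets M" for v
      using A[of v] name_sets_subset simple_functionD(2)[OF X] by (intro sets.Un sets.Diff) auto
    define D where "D x = {v \<in> ?V. x \<in> ?E v}" for x
    have D: "simple_function M D"
      unfolding D_def by (rule simple_function_membership_vector[OF finV E])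
    let ?Y = "symbol_name G"
    have Y: "simple_function M ?Y" by (rule simple_function_symbol_name[OF finG])
    have X_eq: "X x = X y" if x: "x \<in> space M" and y: "y \<in> space M" and Dxy: "D x = D y"
      and I: "itinerary left_shift ?Y k x = itinerary left_shift ?Y k y" for x y
    proof -
      let ?v = "X x"
      have v: "?v \<in> ?V" using x by auto
      have "x \<in> A ?v \<longleftrightarrow> y \<in> A ?v"
        using det'[OF v] x y I I[symmetric] unfolding name_determined_def by blast
      moreover have "x \<in> ?E ?v \<longleftrightarrow> y \<in> ?E ?v"
        using Dxy v unfolding D_def set_eq_iff mem_Collect_eq by blast
      moreover have "x \<in> ?C ?v" using x by simp
      ultimately have "y \<in> ?C ?v" by blast
      then show ?thesis by simp
    qed
    have HD: "obs_entropy M D \<le> ?err e"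
    proof (rule obs_entropy_le_of_dominant_value[OF D])
      show "finite (Pow ?V)" using finV by simp
      show "D ` space M \<subseteq> Pow ?V" by (auto simp: D_def)
      show "{} \<in> Pow ?V" by simp
      have "space M - (D -` {{}} \<inter> space M) \<subseteq> (\<Union>v\<in>?V. ?E v)"
      proof
        fix x assume "x \<in> space M - (D -` {{}} \<inter> space M)"
        then have "D x \<noteq> {}" by blast
        then obtain v where "v \<in> D x" by blast
        then have "v \<in> ?V \<and> x \<in> ?E v" unfolding D_def mem_Collect_eq .
        then show "x \<in> (\<Union>v\<in>?V. ?E v)" by (rule conjE) (rule UN_I)
      qed
      then have "measure M (space M - (D -` {{}} \<inter> space M)) \<le> measure M (\<Union>v\<in>?V. ?E v)"
        using E finV by (intro finite_measure_mono sets.finite_UN) auto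
      also have "\<dots> \<le> (\<Sum>v\<in>?V. measure M (?E v))"
        using E finV by (intro finite_measure_subadditive_finite) auto
      also have "\<dots> \<le> ?N * e"
        by (rule sum_bounded_above) (rule less_imp_le[OF A_close])
      finally show "1 - obs_prob M D {} \<le> ?N * e"
        unfolding obs_prob_def prob_compl[OF simple_functionD(2)[OF D, of "{{}}"], symmetric] .
    qed
    have step: "obs_entropy M (itinerary left_shift X n) / real n \<le>
        obs_entropy M D + obs_entropy M (itinerary left_shift ?Y n) / real n
          + obs_entropy M (itinerary left_shift ?Y k) / real n" if n: "1 \<le> n" for n
    proof -
      \<comment> \<open>The value of \<open>X\<close> at a time \<open>i < n\<close> is decoded from
        the \<open>k\<close> names starting at \<open>i\<close>, so names up to time
        \<open>n + k\<close> are recorded; the \<open>k\<close> extra ones vanish after division by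
        \<open>n\<close>.\<close>
      let ?P = "\<lambda>x. (itinerary left_shift D n x, itinerary left_shift ?Y (n + k) x)"
      have sD: "simple_function M (itinerary left_shift D n)"
        and sY: "simple_function M (itinerary left_shift ?Y (n + k))"
        using D Y by (auto intro: simple_function_itinerary)
      have "obs_entropy M (itinerary left_shift X n) \<le> obs_entropy M ?P"
      proof (rule obs_entropy_mono[OF simple_function_itinerary[OF X] simple_function_Pair[OF sD sY]])
        fix x y assume x: "x \<in> space M" and y: "y \<in> space M" and P: "?P x = ?P y"
        have "X ((left_shift ^^ i) x) = X ((left_shift ^^ i) y)" if i: "i < n" for i
        proof (rule X_eq)
          show "D ((left_shift ^^ i) x) = D ((left_shift ^^ i) y)"
            using P i by (simp add: itinerary_eq_iff)
          show "itinerary left_shift ?Y k ((left_shift ^^ i) x) = itinerary left_shift ?Y k ((left_shift ^^ i) y)"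
            using P i by (simp add: itinerary_eq_iff funpow_left_shift symbol_name_def)
        qed (use x y funpow_space in auto)
        then show "itinerary left_shift X n x = itinerary left_shift X n y"
          by (simp add: itinerary_eq_iff)
      qed
      also have "\<dots> \<le> obs_entropy M (itinerary left_shift D n) + obs_entropy M (itinerary left_shift ?Y (n + k))"
        by (rule obs_entropy_Pair_le[OF sD sY])
      also have "\<dots> \<le> real n * obs_entropy M D +
          (obs_entropy M (itinerary left_shift ?Y n) + obs_entropy M (itinerary left_shift ?Y k))"
        by (intro add_mono obs_entropy_itinerary_le obs_entropy_itinerary_add D Y)
      finally show ?thesis using n by (simp add: field_simps)
    qed
    have "entropy_rate M left_shift X \<le> obs_entropy M D + entropy_rate M left_shift ?Y + 0"
    proof (rule tendsto_le[OF _ _ entropy_rate_lim[OF X]])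
      show "(\<lambda>n. obs_entropy M D + obs_entropy M (itinerary left_shift ?Y n) / real n
          + obs_entropy M (itinerary left_shift ?Y k) / real n)
          \<longlonglongrightarrow> obs_entropy M D + entropy_rate M left_shift ?Y + 0"
        by (intro tendsto_intros entropy_rate_lim[OF Y] lim_const_over_n)
      show "\<forall>\<^sub>F n in sequentially. obs_entropy M (itinerary left_shift X n) / real n \<le>
          obs_entropy M D + obs_entropy M (itinerary left_shift ?Y n) / real n
          + obs_entropy M (itinerary left_shift ?Y k) / real n"
        using step by (intro eventually_sequentiallyI[of 1])
    qed simp
    moreover have "entropy_rate M left_shift ?Y \<le> B" using finG by (intro le) (auto simp: G_def)
    ultimately show ?thesis using HD by simp
  qed
  have "(\<lambda>n. ?err (inverse (real (Suc n))) + B) \<longlonglongrightarrow> ?err 0 + B"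
    by (intro tendsto_intros LIMSEQ_inverse_real_of_nat)
  then have "entropy_rate M left_shift X \<le> ?err 0 + B"
    by (rule LIMSEQ_le_const) (use bound in auto)
  then show ?thesis by simp
qed

lemma ks_entropy_le_of_symbol_names:
  assumes "finite F"
    "\<And>G. finite G \<Longrightarrow> F \<subseteq> G \<Longrightarrow> entropy_rate M left_shift (symbol_name G) \<le> B"
  shows "ks_entropy M left_shift \<le> ereal B"
  using entropy_rate_le_of_symbol_names[OF assms] by (intro ks_entropy_leI) auto

definition avoiding :: "'a set \<Rightarrow> nat \<Rightarrow> (nat \<Rightarrow> 'a) set" where
  "avoiding F k = {x \<in> space M. \<forall>i<k. x i \<notin> F}"

lemma avoiding_in_sets: "avoiding F k \<in> sets M"
proof (induction k)
  case (Suc k)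
  have "avoiding F (Suc k) = avoiding F k \<inter> {x \<in> space M. x k \<in> - F}"
    by (auto simp: avoiding_def less_Suc_eq)
  then show ?case using Suc symbol_set_in_sets[of k "- F"] by auto
qed (simp add: avoiding_def)

end

section \<open>Entropy hidden in excursions\<close>

locale ergodic_markov_measure = markov_measure +
  assumes ergodic: "M \<in> ergodic_measures S"
begin

text \<open>The set \<open>?N\<close> of orbits that never meet \<open>F\<close> is only contained
  in its preimage, so ergodicity is applied to the strictly invariant set \<open>E\<close> of orbits
  that eventually stop meeting \<open>F\<close>. \<open>E\<close> is the increasing union of
  preimages of \<open>?N\<close>, all of the same measure. If \<open>E\<close> had measure 1, so
  would \<open>?N\<close>, which is disjoint from the event of starting in \<open>F\<close>.\<close>

lemma avoiding_tendsto_0: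
  assumes pos: "0 < measure M {x \<in> space M. x 0 \<in> F}"
  shows "(\<lambda>k. measure M (avoiding F k)) \<longlonglongrightarrow> 0"
proof -
  let ?N = "\<Inter>k. avoiding F k"
  have N: "?N \<in> sets M" using avoiding_in_sets by auto
  have N_eq: "?N = {x \<in> space M. \<forall>i. x i \<notin> F}" by (auto simp: avoiding_def)
  have lim: "(\<lambda>k. measure M (avoiding F k)) \<longlonglongrightarrow> measure M ?N"
  proof (rule finite_Lim_measure_decseq)
    show "range (avoiding F) \<subseteq> sets M" using avoiding_in_sets by blast
    show "decseq (avoiding F)" by (fastforce simp: decseq_def avoiding_def)
  qed
  define J where "J k = (left_shift ^^ k) -` ?N \<inter> space M" for k
  define E where "E = (\<Union>k. J k)"
  have J: "J k = {x \<in> space M. \<forall>i. x (k + i) \<notin> F}" for k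
    unfolding J_def N_eq using funpow_space[of _ k] by (auto simp: funpow_left_shift)
  have Jm: "J k \<in> sets M" for k unfolding J_def using measurable_sets[OF funpow_measurable N] .
  have E_eq: "E = {x \<in> space M. \<exists>k. \<forall>i\<ge>k. x i \<notin> F}"
    unfolding E_def J by (auto simp: le_iff_add)
  have "left_shift -` E \<inter> space M = E"
  proof -
    have "(\<exists>k. \<forall>i\<ge>k. x (Suc i) \<notin> F) \<longleftrightarrow> (\<exists>k. \<forall>i\<ge>k. x i \<notin> F)" for x :: "nat \<Rightarrow> 'a"
    proof
      assume "\<exists>k. \<forall>i\<ge>k. x (Suc i) \<notin> F"
      then obtain k where k: "\<And>i. i \<ge> k \<Longrightarrow> x (Suc i) \<notin> F" by auto
      have "x i \<notin> F" if "i \<ge> Suc k" for i using k[of "i - 1"] that by (cases i) auto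
      then show "\<exists>k. \<forall>i\<ge>k. x i \<notin> F" by blast
    next
      assume "\<exists>k. \<forall>i\<ge>k. x i \<notin> F"
      then show "\<exists>k. \<forall>i\<ge>k. x (Suc i) \<notin> F" by (meson le_Suc_eq)
    qed
    then show ?thesis unfolding E_eq using T_space by (auto simp: left_shift_def)
  qed
  moreover have Em: "E \<in> sets M" unfolding E_def using Jm by auto
  ultimately consider "measure M E = 0" | "measure M E = 1"
    using ergodic by (auto simp: ergodic_measures_def)
  then have "measure M ?N = 0"
  proof cases
    case 1
    have "?N \<subseteq> E" unfolding N_eq E_eq by auto
    then have "measure M ?N \<le> measure M E" using Em by (intro finite_measure_mono)
    then show ?thesis using 1 measure_nonneg[of M ?N] by linarith
  next
    case 2
    have "incseq J" unfolding J incseq_def by (auto simp: le_iff_add add.assoc)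
    then have "(\<lambda>k. measure M (J k)) \<longlonglongrightarrow> measure M E"
      unfolding E_def using Jm by (intro finite_Lim_measure_incseq) auto
    moreover have "measure M (J k) = measure M ?N" for k
      unfolding J_def by (rule measure_funpow_vimage[OF N])
    ultimately have "measure M ?N = 1" using 2 LIMSEQ_unique[OF tendsto_const] by force
    moreover have "measure M ?N + measure M {x \<in> space M. x 0 \<in> F} \<le> 1"
    proof -
      have "measure M ?N + measure M {x \<in> space M. x 0 \<in> F} = measure M (?N \<union> {x \<in> space M. x 0 \<in> F})"
        using N symbol_set_in_sets[of 0 F] N_eq by (intro finite_measure_Union[symmetric]) auto
      then show ?thesis by simp
    qed
    ultimately show ?thesis using pos by simp
  qed
  then show ?thesis using lim by simp
qed

end

lemma length_takeWhile_le_index: "i < length xs \<Longrightarrow> \<not> P (xs ! i) \<Longrightarrow> length (takeWhile P xs) \<le> i"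
  by (metis leI nth_mem set_takeWhileD takeWhile_nth)

lemma length_filter_map_upt:
  "real (length (filter P (map g [0..<n]))) = (\<Sum>i<n. if P (g i) then 1 else 0)"
  by (induction n) auto

locale ergodic_bridge_bound = ergodic_markov_measure S M + bridge_bound S F F' G c \<beta> L
  for S :: "'a::countable \<Rightarrow> 'a \<Rightarrow> bool" and M F F' G c \<beta> L +
  assumes visits: "0 < measure M {x \<in> space M. x 0 \<in> F}"
begin

abbreviation "K \<equiv> ln (real (card G + 1))"

abbreviation "coarse_name n \<equiv> itinerary left_shift (symbol_name F') n"

text \<open>The exponent in the count of refinements, as a function of the coarse name
  alone.\<close>

definition cost :: "'a option list \<Rightarrow> real" where
  "cost y = (c + 1) * real (length (filter off_F y)) +
     K * (real (length (takeWhile off_F y)) + real (length (takeWhile off_F (rev y))))"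

lemma off_F_collapse [simp]: "off_F (collapse F' a) \<longleftrightarrow> a \<notin> F"
  using FF' by (auto simp: collapse_def)

text \<open>The fine itineraries over a given coarse one are among its refined words, so the fibre
  count turns into an expected cost.\<close>

lemma obs_entropy_fine_le_coarse:
  "obs_entropy M (itinerary left_shift (symbol_name G) n) \<le>
     obs_entropy M (coarse_name n) + (\<integral>x. cost (coarse_name n x) \<partial>M)"
proof -
  let ?X = "itinerary left_shift (symbol_name G) n"
  \<comment> \<open>The map from \<open>G\<close>-names to \<open>F'\<close>-names; it can be read
    off letter by letter because \<open>F'\<close> is contained in \<open>G\<close>.\<close>
  define f where "f = map (\<lambda>z. case z of None \<Rightarrow> None | Some a \<Rightarrow> collapse F' a)"
  have f: "f (map (collapse G) w) = map (collapse F') w" for w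
    using F'G by (auto simp: f_def collapse_def)
  have fX: "f (?X x) = coarse_name n x" for x
    by (simp only: itinerary_symbol_name f)
  have X: "simple_function M ?X"
    by (intro simple_function_itinerary simple_function_symbol_name G)
  have "obs_entropy M ?X \<le> obs_entropy M (\<lambda>x. f (?X x)) + (\<integral>x. cost (f (?X x)) \<partial>M)"
  proof (rule obs_entropy_le_image_plus_log_fibers[OF X])
    fix x assume "x \<in> space M"
    have "{v \<in> ?X ` space M. f v = f (?X x)} \<subseteq> refined_words S G F' (f (?X x))"
    proof
      fix v assume "v \<in> {v \<in> ?X ` space M. f v = f (?X x)}"
      then obtain z where z: "z \<in> space M" "v = ?X z" and fv: "f v = f (?X x)" by auto
      have "successively S (map z [0..<n])"
        using z(1) by (auto simp: successively_conv_nth space_eq markov_shift_def)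
      moreover have "v = map (collapse G) (map z [0..<n])" using z(2) by (simp only: itinerary_symbol_name)
      moreover from this have "map (collapse F') (map z [0..<n]) = f (?X x)" using fv f by metis
      ultimately show "v \<in> refined_words S G F' (f (?X x))" unfolding refined_words_def by blast
    qed
    then have "card {v \<in> ?X ` space M. f v = f (?X x)} \<le> card (refined_words S G F' (f (?X x)))"
      by (rule card_mono[OF finite_refined_words[OF G]])
    then show "real (card {v \<in> ?X ` space M. f v = f (?X x)}) \<le> exp (cost (f (?X x)))"
      using card_refined_words_boundary[of "f (?X x)"] unfolding cost_def by linarith
  qed
  then show ?thesis by (simp only: fX)
qed

text \<open>A visit to \<open>F\<close> among the first \<open>k\<close> symbols stops the initial
  stretch; otherwise the point avoids \<open>F\<close> for \<open>k\<close> steps and the trivial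
  bound \<open>n\<close> is used.\<close>

lemma length_takeWhile_coarse_name:
  assumes "k \<le> n" "x \<in> space M"
  shows "real (length (takeWhile off_F (coarse_name n x))) \<le>
    real k + real n * indicator (avoiding F k) x"
proof (cases "x \<in> avoiding F k")
  case True
  have "length (takeWhile off_F (coarse_name n x)) \<le> n"
    using length_takeWhile_le[of off_F "coarse_name n x"] by simp
  then show ?thesis using True by simp
next
  case False
  then obtain i where i: "i < k" "x i \<in> F" using assms by (auto simp: avoiding_def)
  then have "length (takeWhile off_F (coarse_name n x)) \<le> i"
    using assms by (intro length_takeWhile_le_index) (auto simp: itinerary_symbol_name)
  then show ?thesis using i False by simp
qed

lemma length_takeWhile_rev_coarse_name:
  assumes "k \<le> n" "x \<in> space M"
  shows "real (length (takeWhile off_F (rev (coarse_name n x)))) \<le>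
    real k + real n * indicator (avoiding F k) ((left_shift ^^ (n - k)) x)"
proof (cases "(left_shift ^^ (n - k)) x \<in> avoiding F k")
  case True
  have "length (takeWhile off_F (rev (coarse_name n x))) \<le> n"
    using length_takeWhile_le[of off_F "rev (coarse_name n x)"] by simp
  then show ?thesis using True by simp
next
  case False
  then obtain i where i: "i < k" "x (n - k + i) \<in> F"
    using funpow_space[OF assms(2), of "n - k"] by (auto simp: avoiding_def funpow_left_shift)
  \<comment> \<open>A visit at position \<open>i\<close> of the last \<open>k\<close> symbols sits
    at position \<open>k - 1 - i\<close> of the reversed word.\<close>
  have eq: "n - Suc (k - 1 - i) = n - k + i" using i assms by simp
  have "rev (coarse_name n x) ! (k - 1 - i) = collapse F' (x (n - k + i))"
    using i assms by (subst rev_nth) (simp_all add: itinerary_symbol_name eq[simplified])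
  then have "length (takeWhile off_F (rev (coarse_name n x))) \<le> k - 1 - i"
    using assms i by (intro length_takeWhile_le_index) auto
  then show ?thesis using i False by simp
qed

text \<open>By invariance each of the \<open>n\<close> times has the same probability of being
  outside \<open>F\<close>, and the final window avoids \<open>F\<close> with the same probability
  as the initial one.\<close>

lemma expectation_cost_le:
  assumes k: "k \<le> n"
  shows "(\<integral>x. cost (coarse_name n x) \<partial>M) \<le>
    (c + 1) * (real n * measure M {x \<in> space M. x 0 \<notin> F}) +
    K * (2 * real k + 2 * (real n * measure M (avoiding F k)))"
proof -
  let ?A = "{x \<in> space M. x 0 \<in> - F}"
  let ?T = "\<lambda>i. left_shift ^^ i"
  let ?g = "\<lambda>x. (c + 1) * (\<Sum>i<n. indicator (?T i -` ?A \<inter> space M) x) +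
    K * ((real k + real n * indicator (avoiding F k) x) +
      (real k + real n * indicator (?T (n - k) -` avoiding F k \<inter> space M) x))"
  have K: "0 \<le> K" by simp
  have Am: "?A \<in> sets M" by (rule symbol_set_in_sets)
  have TA: "?T i -` ?A \<inter> space M \<in> sets M" for i by (rule measurable_sets[OF funpow_measurable Am])
  have TN: "?T i -` avoiding F k \<inter> space M \<in> sets M" for i
    by (rule measurable_sets[OF funpow_measurable avoiding_in_sets])
  have int: "integrable M (indicator B :: _ \<Rightarrow> real)" if "B \<in> sets M" for B
    using that by (simp add: less_top[symmetric])
  have int_g: "integrable M ?g"
    by (intro Bochner_Integration.integrable_add integrable_mult_right Bochner_Integration.integrable_sum
        int TA TN avoiding_in_sets integrable_const)
  have "(\<integral>x. cost (coarse_name n x) \<partial>M) \<le> (\<integral>x. ?g x \<partial>M)"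
  proof (rule integral_mono)
    have "simple_function M (coarse_name n)"
      using finite_subset[OF F'G G] by (intro simple_function_itinerary simple_function_symbol_name)
    then show "integrable M (\<lambda>x. cost (coarse_name n x))" by (rule integrable_comp_simple_function)
    show "integrable M ?g" by (rule int_g)
    fix x assume x: "x \<in> space M"
    have "real (length (filter off_F (coarse_name n x))) =
        (\<Sum>i<n. indicator (?T i -` ?A \<inter> space M) x)"
      unfolding itinerary_symbol_name map_map length_filter_map_upt
      using x funpow_space[OF x] by (intro sum.cong) (auto simp: indicator_def funpow_left_shift)
    moreover have "K * (real (length (takeWhile off_F (coarse_name n x))) +
          real (length (takeWhile off_F (rev (coarse_name n x))))) \<le>
        K * ((real k + real n * indicator (avoiding F k) x) +
          (real k + real n * indicator (?T (n - k) -` avoiding F k \<inter> space M) x))"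
      using length_takeWhile_coarse_name[OF k x] length_takeWhile_rev_coarse_name[OF k x] x
      by (intro mult_left_mono[OF _ K] add_mono) (auto simp: indicator_def)
    ultimately show "cost (coarse_name n x) \<le> ?g x" unfolding cost_def by simp
  qed
  also have "(\<integral>x. ?g x \<partial>M) = (c + 1) * (\<Sum>i<n. measure M (?T i -` ?A \<inter> space M)) +
      K * ((real k + real n * measure M (avoiding F k)) +
        (real k + real n * measure M (?T (n - k) -` avoiding F k \<inter> space M)))"
    using int TA TN[of "n - k"] avoiding_in_sets[of F k]
    by (simp add: Bochner_Integration.integral_add Bochner_Integration.integral_sum
        integrable_mult_right Bochner_Integration.integrable_sum Bochner_Integration.integrable_add
        prob_space)
  also have "\<dots> = (c + 1) * (real n * measure M ?A) +
      K * (2 * real k + 2 * (real n * measure M (avoiding F k)))"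
    unfolding measure_funpow_vimage[OF Am] measure_funpow_vimage[OF avoiding_in_sets] by simp
  finally show ?thesis by simp
qed

text \<open>Divide by \<open>n\<close> and let \<open>n\<close> tend to infinity with
  \<open>k\<close> fixed, which removes the term \<open>2 * real k\<close>; then let
  \<open>k\<close> tend to infinity. Both limits are taken for a fixed \<open>G\<close>, so
  \<open>K\<close> leaves no trace and the final bound is uniform in \<open>G\<close>.\<close>

lemma entropy_rate_fine_le_coarse:
  "entropy_rate M left_shift (symbol_name G) \<le>
     entropy_rate M left_shift (symbol_name F') + (c + 1) * measure M {x \<in> space M. x 0 \<notin> F}"
proof -
  let ?q = "measure M {x \<in> space M. x 0 \<notin> F}"
  let ?rG = "entropy_rate M left_shift (symbol_name G)"
  let ?rF = "entropy_rate M left_shift (symbol_name F')"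
  have sG: "simple_function M (symbol_name G)" and sF: "simple_function M (symbol_name F')"
    using G finite_subset[OF F'G G] by (auto intro: simple_function_symbol_name)
  have "?rG \<le> ?rF + (c + 1) * ?q + K * (0 + 2 * measure M (avoiding F k))" for k
  proof (rule tendsto_le[OF _ _ entropy_rate_lim[OF sG]])
    show "(\<lambda>n. obs_entropy M (coarse_name n) / real n + (c + 1) * ?q +
        K * ((2 * real k) / real n + 2 * measure M (avoiding F k)))
      \<longlonglongrightarrow> ?rF + (c + 1) * ?q + K * (0 + 2 * measure M (avoiding F k))"
      by (intro tendsto_intros entropy_rate_lim[OF sF] lim_const_over_n)
    show "\<forall>\<^sub>F n in sequentially. obs_entropy M (itinerary left_shift (symbol_name G) n) / real n \<le>
        obs_entropy M (coarse_name n) / real n + (c + 1) * ?q +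
        K * ((2 * real k) / real n + 2 * measure M (avoiding F k))"
    proof (rule eventually_sequentiallyI[of "Suc k"])
      fix n assume n: "Suc k \<le> n"
      have "obs_entropy M (itinerary left_shift (symbol_name G) n) \<le> obs_entropy M (coarse_name n) +
          ((c + 1) * (real n * ?q) + K * (2 * real k + 2 * (real n * measure M (avoiding F k))))"
        using obs_entropy_fine_le_coarse[of n] expectation_cost_le[of k n] n by linarith
      then have "obs_entropy M (itinerary left_shift (symbol_name G) n) / real n \<le>
          (obs_entropy M (coarse_name n) +
          ((c + 1) * (real n * ?q) + K * (2 * real k + 2 * (real n * measure M (avoiding F k))))) / real n"
        by (rule divide_right_mono) simp
      also have "\<dots> = obs_entropy M (coarse_name n) / real n + (c + 1) * ?q +
          K * ((2 * real k) / real n + 2 * measure M (avoiding F k))"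
        using n by (simp add: add_divide_distrib distrib_left)
      finally show "obs_entropy M (itinerary left_shift (symbol_name G) n) / real n \<le>
        obs_entropy M (coarse_name n) / real n + (c + 1) * ?q +
        K * ((2 * real k) / real n + 2 * measure M (avoiding F k))" .
    qed
  qed simp
  moreover have "(\<lambda>k. ?rF + (c + 1) * ?q + K * (0 + 2 * measure M (avoiding F k)))
      \<longlonglongrightarrow> ?rF + (c + 1) * ?q + K * (0 + 2 * 0)"
    by (intro tendsto_intros avoiding_tendsto_0 visits)
  ultimately have "?rG \<le> ?rF + (c + 1) * ?q + K * (0 + 2 * 0)"
    by (intro LIMSEQ_le_const) auto
  then show ?thesis by simp
qed

end

section \<open>Exponential growth of loops\<close>

text \<open>A shift-invariant event lies in the tail of the independent coordinates, so Kolmogorov's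
  zero-one law applies.\<close>

lemma iid_shift_zero_one:
  fixes N :: "'b measure" and C :: "(nat \<Rightarrow> 'b) set"
  defines "P \<equiv> PiM UNIV (\<lambda>_::nat. N)"
  assumes "prob_space N" and C: "C \<in> sets P"
    and inv: "\<And>\<omega>. \<omega> \<in> space P \<Longrightarrow> (\<lambda>i. \<omega> (Suc i)) \<in> C \<longleftrightarrow> \<omega> \<in> C"
  shows "measure P C = 0 \<or> measure P C = 1"
proof -
  interpret N: prob_space N by fact
  interpret P: product_prob_space "\<lambda>_::nat. N" UNIV by unfold_locales
  have comp: "(\<lambda>\<omega>. \<omega> i) \<in> measurable P N" for i
    unfolding P_def by (rule measurable_component_singleton) simp
  define A where "A i = sigma_sets (space P) {(\<lambda>\<omega>. \<omega> i) -` B \<inter> space P | B. B \<in> sets N}" for i :: nat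
  have "P.indep_vars (\<lambda>_. N) (\<lambda>i \<omega>. \<omega> i) UNIV"
  proof (subst P.indep_vars_iff_distr_eq_PiM')
    show "distr (PiM UNIV (\<lambda>_::nat. N)) (PiM UNIV (\<lambda>_::nat. N)) (\<lambda>x. \<lambda>i\<in>UNIV. x i) =
        PiM UNIV (\<lambda>i. distr (PiM UNIV (\<lambda>_::nat. N)) N (\<lambda>\<omega>. \<omega> i))"
      by (simp add: P.PiM_component restrict_UNIV distr_id2)
  qed auto
  then have indep: "P.indep_sets A UNIV"
    unfolding P.indep_vars_def A_def P_def by simp
  have shift_n: "(\<lambda>i. \<omega> (n + i)) \<in> C \<longleftrightarrow> \<omega> \<in> C" if "\<omega> \<in> space P" for \<omega> n
    using that
  proof (induction n arbitrary: \<omega>)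
    case (Suc n)
    have "(\<lambda>i. \<omega> (Suc i)) \<in> space P"
      using Suc.prems by (auto simp: P_def space_PiM)
    from Suc.IH[OF this] show ?case using inv[OF Suc.prems] by simp
  qed simp
  have "C \<in> P.tail_events A"
    unfolding P.tail_events_def
  proof
    fix n :: nat
    let ?G = "\<Union> (A ` {n..})"
    let ?R = "sigma (space P) ?G"
    have G: "?G \<subseteq> Pow (space P)"
      unfolding A_def by (auto dest: sigma_sets_into_sp[rotated])
    have R: "space ?R = space P" "sets ?R = sigma_sets (space P) ?G"
      using G by (simp_all add: sets_measure_of space_measure_of)
    have "(\<lambda>\<omega> i. \<omega> (n + i)) \<in> measurable ?R P"
      unfolding P_def
    proof (rule measurable_PiM_single')
      fix i :: nat
      show "(\<lambda>\<omega>. \<omega> (n + i)) \<in> measurable (sigma (space (PiM UNIV (\<lambda>_::nat. N))) ?G) N"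
        unfolding P_def[symmetric]
      proof (rule measurableI)
        fix \<omega> assume "\<omega> \<in> space ?R"
        then show "\<omega> (n + i) \<in> space N" unfolding R using measurable_space[OF comp] by auto
      next
        fix B assume "B \<in> sets N"
        then have "(\<lambda>\<omega>. \<omega> (n + i)) -` B \<inter> space P \<in> A (n + i)"
          unfolding A_def by (intro sigma_sets.Basic) auto
        then have "(\<lambda>\<omega>. \<omega> (n + i)) -` B \<inter> space P \<in> ?G" by (intro UN_I[of "n + i"]) auto
        then show "(\<lambda>\<omega>. \<omega> (n + i)) -` B \<inter> space ?R \<in> sets ?R"
          unfolding R by (rule sigma_sets.Basic)
      qed
    next
      show "(\<lambda>\<omega> i. \<omega> (n + i)) \<in> space (sigma (space (PiM UNIV (\<lambda>_::nat. N))) ?G) \<rightarrow> (\<Pi>\<^sub>E i\<in>UNIV. space N)"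
        unfolding P_def[symmetric] R by (auto simp: P_def space_PiM)
    qed
    from measurable_sets[OF this C]
    have "(\<lambda>\<omega> i. \<omega> (n + i)) -` C \<inter> space P \<in> sigma_sets (space P) ?G" unfolding R .
    \<comment> \<open>By invariance \<open>C\<close> is its own preimage under a map that reads only
      the coordinates from \<open>n\<close> on.\<close>
    also have "(\<lambda>\<omega> i. \<omega> (n + i)) -` C \<inter> space P = C"
      using shift_n sets.sets_into_space[OF C] by auto
    finally show "C \<in> sigma_sets (space (PiM UNIV (\<lambda>_::nat. N))) ?G" unfolding P_def .
  qed
  moreover have "sigma_algebra (space (PiM UNIV (\<lambda>_::nat. N))) (A i)" for i
    unfolding A_def P_def by (rule sigma_algebra_sigma_sets) auto
  ultimately show ?thesis
    using P.kolmogorov_0_1_law[OF _ indep] unfolding P_def by blast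
qed

lemma distr_iid_shift:
  assumes "prob_space N"
  shows "distr (PiM UNIV (\<lambda>_::nat. N)) (PiM UNIV (\<lambda>_::nat. N)) (\<lambda>\<omega> i. \<omega> (Suc i)) = PiM UNIV (\<lambda>_::nat. N)"
  using distr_PiM_reindex[of UNIV "\<lambda>_::nat. N" Suc UNIV] assms by (simp add: restrict_UNIV)

section \<open>Ergodic measures from independent concatenation of blocks\<close>

locale block_code =
  fixes S :: "'a::countable \<Rightarrow> 'a \<Rightarrow> bool" and W :: "'a list set" and n :: nat
  assumes n_pos: "0 < n" and finite_W: "finite W" and W_nonempty: "W \<noteq> {}"
    and length_W: "\<And>w. w \<in> W \<Longrightarrow> length w = n"
    and admissible: "\<And>v w. v \<in> W \<Longrightarrow> w \<in> W \<Longrightarrow> successively S (v @ w)"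
begin

definition block_measure :: "'a list measure" where "block_measure = uniform_count_measure W"

definition block_seqs :: "(nat \<Rightarrow> 'a list) measure" where
  "block_seqs = PiM UNIV (\<lambda>_. block_measure)"

definition unblock :: "(nat \<Rightarrow> 'a list) \<Rightarrow> nat \<Rightarrow> 'a" where
  "unblock \<omega> i = \<omega> (i div n) ! (i mod n)"

lemma space_block_measure [simp]: "space block_measure = W"
  and sets_block_measure [simp]: "sets block_measure = Pow W"
  by (simp_all add: block_measure_def space_uniform_count_measure sets_uniform_count_measure)

lemma prob_block_measure: "prob_space block_measure"
  unfolding block_measure_def by (rule prob_space_uniform_count_measure[OF finite_W W_nonempty])

lemma space_block_seqs: "space block_seqs = {\<omega>. \<forall>j. \<omega> j \<in> W}"
  by (auto simp: block_seqs_def space_PiM PiE_def Pi_def)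

lemma prob_block_seqs: "prob_space block_seqs"
  unfolding block_seqs_def by (rule prob_space_PiM) (rule prob_block_measure)

lemma unblock_in_markov_shift:
  assumes "\<omega> \<in> space block_seqs"
  shows "unblock \<omega> \<in> markov_shift S"
  unfolding markov_shift_def
proof (rule CollectI, rule allI)
  fix i
  let ?j = "i div n" and ?m = "i mod n"
  have W: "\<omega> j \<in> W" for j using assms by (simp add: space_block_seqs)
  have m: "?m < n" using n_pos by simp
  have len: "length (\<omega> j) = n" for j using length_W W by simp
  have adm: "successively S (\<omega> ?j @ \<omega> (Suc ?j))" using admissible W by simp
  then have "S ((\<omega> ?j @ \<omega> (Suc ?j)) ! ?m) ((\<omega> ?j @ \<omega> (Suc ?j)) ! Suc ?m)"
    using m by (auto simp: successively_conv_nth len)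
  then show "S (unblock \<omega> i) (unblock \<omega> (Suc i))"
    using m len by (cases "Suc ?m = n") (auto simp: unblock_def nth_append mod_Suc div_Suc)
qed

lemma unblock_shift: "unblock (\<lambda>j. \<omega> (Suc j)) = (left_shift ^^ n) (unblock \<omega>)"
  using n_pos by (auto simp: unblock_def funpow_left_shift)

lemma unblock_coordinate_set:
  "{\<omega> \<in> space block_seqs. unblock \<omega> i = a} \<in> sets block_seqs"
proof -
  have "(\<lambda>\<omega>. \<omega> (i div n)) \<in> measurable block_seqs block_measure"
    unfolding block_seqs_def by (rule measurable_component_singleton) simp
  from measurable_sets[OF this, of "{w \<in> W. w ! (i mod n) = a}"]
  have "(\<lambda>\<omega>. \<omega> (i div n)) -` {w \<in> W. w ! (i mod n) = a} \<inter> space block_seqs \<in> sets block_seqs"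
    by auto
  also have "(\<lambda>\<omega>. \<omega> (i div n)) -` {w \<in> W. w ! (i mod n) = a} \<inter> space block_seqs =
      {\<omega> \<in> space block_seqs. unblock \<omega> i = a}"
    by (auto simp: unblock_def space_block_seqs)
  finally show ?thesis .
qed

lemma measurable_unblock: "unblock \<in> measurable block_seqs (shift_borel S)"
proof (rule measurable_sigma_sets[OF sets_shift_borel_cylinders])
  show "range (cylinder S) \<subseteq> Pow (markov_shift S)" using cylinder_subset by auto
  show "unblock \<in> space block_seqs \<rightarrow> markov_shift S" using unblock_in_markov_shift by auto
next
  fix y assume "y \<in> range (cylinder S)"
  then obtain w where w: "y = cylinder S w" by auto
  have "{\<omega> \<in> space block_seqs. \<forall>i\<in>{..<length w}. unblock \<omega> i = w ! i} \<in> sets block_seqs"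
    by (intro sets.sets_Collect_finite_All unblock_coordinate_set) auto
  also have "{\<omega> \<in> space block_seqs. \<forall>i\<in>{..<length w}. unblock \<omega> i = w ! i} =
      unblock -` y \<inter> space block_seqs"
    using unblock_in_markov_shift by (auto simp: w cylinder_def)
  finally show "unblock -` y \<inter> space block_seqs \<in> sets block_seqs" .
qed

lemma measurable_funpow_unblock:
  "(\<lambda>\<omega>. (left_shift ^^ k) (unblock \<omega>)) \<in> measurable block_seqs (shift_borel S)"
  by (rule measurable_compose[OF measurable_unblock measurable_compose_n[OF measurable_left_shift]])

text \<open>The concatenation of independent blocks is only invariant under the \<open>n\<close>-th power of the shift;
  a uniformly distributed initial phase makes it invariant under the shift.\<close>

definition phased :: "(nat \<Rightarrow> 'a) measure" where
  "phased = distr (uniform_count_measure {..<n} \<Otimes>\<^sub>M block_seqs) (shift_borel S)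
     (\<lambda>(k, \<omega>). (left_shift ^^ k) (unblock \<omega>))"

text \<open>Meaningful for every \<open>k\<close>, so that phase \<open>n\<close> can be compared
  with phase 0.\<close>

definition phase_prob :: "nat \<Rightarrow> (nat \<Rightarrow> 'a) set \<Rightarrow> real" where
  "phase_prob k B = measure block_seqs {\<omega> \<in> space block_seqs. (left_shift ^^ k) (unblock \<omega>) \<in> B}"

lemma measurable_phased:
  "(\<lambda>(k, \<omega>). (left_shift ^^ k) (unblock \<omega>)) \<in>
     measurable (uniform_count_measure {..<n} \<Otimes>\<^sub>M block_seqs) (shift_borel S)"
proof -
  have "(\<lambda>(k, \<omega>). (left_shift ^^ k) (unblock \<omega>)) \<in>
      measurable (count_space {..<n} \<Otimes>\<^sub>M block_seqs) (shift_borel S)"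
    by (rule measurable_pair_measure_countable1) (auto intro: measurable_funpow_unblock)
  also have "measurable (count_space {..<n} \<Otimes>\<^sub>M block_seqs) (shift_borel S) =
      measurable (uniform_count_measure {..<n} \<Otimes>\<^sub>M block_seqs) (shift_borel S)"
    by (intro measurable_cong_sets sets_pair_measure_cong) (simp_all add: sets_uniform_count_measure)
  finally show ?thesis .
qed

lemma sets_phased [simp]: "sets phased = sets (shift_borel S)"
  and space_phased [simp]: "space phased = markov_shift S"
  by (simp_all add: phased_def space_shift_borel)

lemma prob_phased: "prob_space phased"
proof -
  interpret U: prob_space "uniform_count_measure {..<n}"
    using n_pos by (intro prob_space_uniform_count_measure) auto
  interpret B: prob_space block_seqs by (rule prob_block_seqs)
  interpret pair_prob_space "uniform_count_measure {..<n}" block_seqs ..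
  show ?thesis unfolding phased_def by (rule prob_space_distr[OF measurable_phased])
qed

lemma measure_phased:
  assumes B: "B \<in> sets (shift_borel S)"
  shows "measure phased B = (\<Sum>k<n. phase_prob k B) / real n"
proof -
  interpret B: prob_space block_seqs by (rule prob_block_seqs)
  let ?U = "uniform_count_measure {..<n}"
  let ?f = "\<lambda>(k, \<omega>). (left_shift ^^ k) (unblock \<omega>)"
  let ?X = "?f -` B \<inter> space (?U \<Otimes>\<^sub>M block_seqs)"
  have X: "?X \<in> sets (?U \<Otimes>\<^sub>M block_seqs)" by (rule measurable_sets[OF measurable_phased B])
  have slice: "emeasure block_seqs (Pair k -` ?X) = ennreal (phase_prob k B)" if "k < n" for k
  proof -
    have "Pair k -` ?X = {\<omega> \<in> space block_seqs. (left_shift ^^ k) (unblock \<omega>) \<in> B}"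
      using that by (auto simp: space_pair_measure space_uniform_count_measure)
    then show ?thesis by (simp add: phase_prob_def B.emeasure_eq_measure)
  qed
  have "emeasure phased B = emeasure (?U \<Otimes>\<^sub>M block_seqs) ?X"
    unfolding phased_def by (rule emeasure_distr[OF measurable_phased B])
  also have "\<dots> = (\<integral>\<^sup>+k. emeasure block_seqs (Pair k -` ?X) \<partial>?U)"
    by (rule B.emeasure_pair_measure_alt[OF X])
  also have "\<dots> = (\<Sum>k<n. ennreal (1 / real n) * emeasure block_seqs (Pair k -` ?X))"
    unfolding uniform_count_measure_def by (subst nn_integral_point_measure_finite) simp_all
  also have "\<dots> = (\<Sum>k<n. ennreal (phase_prob k B / real n))"
    by (intro sum.cong refl) (simp add: slice phase_prob_def ennreal_mult[symmetric] del: vimage_Int)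
  also have "\<dots> = ennreal (\<Sum>k<n. phase_prob k B / real n)"
    by (rule sum_ennreal) (simp add: phase_prob_def)
  also have "(\<Sum>k<n. phase_prob k B / real n) = (\<Sum>k<n. phase_prob k B) / real n"
    by (simp add: sum_divide_distrib)
  finally show ?thesis
    by (simp add: measure_def phase_prob_def sum_nonneg)
qed

text \<open>Shifting the symbols by \<open>n\<close> drops exactly one block, which does not change
  the law of a sequence of independent identically distributed blocks.\<close>

lemma phase_prob_add_period:
  assumes B: "B \<in> sets (shift_borel S)"
  shows "phase_prob n B = phase_prob 0 B"
proof -
  let ?C = "{\<omega> \<in> space block_seqs. unblock \<omega> \<in> B}"
  let ?\<theta> = "\<lambda>\<omega> i. \<omega> (Suc i)"
  have C: "?C \<in> sets block_seqs"
    using measurable_sets[OF measurable_unblock B] by (simp add: vimage_def Int_def conj_commute)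
  have \<theta>: "?\<theta> \<in> measurable block_seqs block_seqs"
    unfolding block_seqs_def
    by (rule measurable_PiM_single') (auto intro: measurable_component_singleton simp: space_PiM)
  have "measure block_seqs ?C = measure (distr block_seqs block_seqs ?\<theta>) ?C"
    using distr_iid_shift[OF prob_block_measure] by (simp add: block_seqs_def)
  also have "\<dots> = measure block_seqs (?\<theta> -` ?C \<inter> space block_seqs)"
    by (rule measure_distr[OF \<theta> C])
  also have "?\<theta> -` ?C \<inter> space block_seqs =
      {\<omega> \<in> space block_seqs. (left_shift ^^ n) (unblock \<omega>) \<in> B}"
    by (auto simp: unblock_shift[symmetric] space_block_seqs)
  finally show ?thesis by (simp add: phase_prob_def)
qed

text \<open>A preimage under the shift turns phase \<open>k\<close> into phase \<open>k + 1\<close>;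
  over a full period the sum is unchanged because phase \<open>n\<close> agrees with phase
  0.\<close>

lemma phased_invariant: "phased \<in> invariant_measures S"
proof -
  interpret prob_space phased by (rule prob_phased)
  have "measure phased (left_shift -` B \<inter> space phased) = measure phased B"
    if B: "B \<in> sets (shift_borel S)" for B
  proof -
    let ?B' = "left_shift -` B \<inter> markov_shift S"
    have B': "?B' \<in> sets (shift_borel S)"
      using measurable_sets[OF measurable_left_shift B] by (simp add: space_shift_borel)
    have "(left_shift ^^ k) (unblock \<omega>) \<in> markov_shift S" if "\<omega> \<in> space block_seqs" for k \<omega>
      using measurable_space[OF measurable_funpow_unblock that] by (simp add: space_shift_borel)
    then have "phase_prob k ?B' = phase_prob (Suc k) B" for k
      unfolding phase_prob_def by (intro arg_cong[of _ _ "measure block_seqs"]) auto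
    then have "(\<Sum>k<n. phase_prob k ?B') = (\<Sum>k<n. phase_prob (Suc k) B)" by simp
    also have "\<dots> = (\<Sum>k<n. phase_prob k B)"
      using sum.lessThan_Suc_shift[of "\<lambda>k. phase_prob k B" n] phase_prob_add_period[OF B] by simp
    finally show ?thesis using measure_phased[OF B] measure_phased[OF B'] by simp
  qed
  then show ?thesis
    unfolding invariant_measures_def by (auto simp: emeasure_eq_measure prob_phased)
qed

text \<open>For an invariant set all phases see the same event of block sequences. That event is
  invariant under dropping a block, so it has probability 0 or 1, and so has the average over the
  phases.\<close>

lemma phased_ergodic: "phased \<in> ergodic_measures S"
  unfolding ergodic_measures_def
proof (intro CollectI conjI phased_invariant ballI impI)
  fix B assume "B \<in> sets phased" and inv: "left_shift -` B \<inter> space phased = B"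
  then have B: "B \<in> sets (shift_borel S)" by simp
  have mem: "left_shift x \<in> B \<longleftrightarrow> x \<in> B" if "x \<in> markov_shift S" for x
    using inv that by auto
  have shift: "(left_shift ^^ k) x \<in> markov_shift S \<and> ((left_shift ^^ k) x \<in> B \<longleftrightarrow> x \<in> B)"
    if "x \<in> markov_shift S" for x k
    using that by (induction k) (auto simp: mem left_shift_in_markov_shift)
  let ?C = "{\<omega> \<in> space block_seqs. unblock \<omega> \<in> B}"
  have C: "?C \<in> sets block_seqs"
    using measurable_sets[OF measurable_unblock B] by (simp add: vimage_def Int_def conj_commute)
  have "measure block_seqs ?C = 0 \<or> measure block_seqs ?C = 1"
    unfolding block_seqs_def
  proof (rule iid_shift_zero_one[OF prob_block_measure])
    fix \<omega> assume "\<omega> \<in> space (PiM UNIV (\<lambda>_::nat. block_measure))"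
    then have \<omega>: "\<omega> \<in> space block_seqs" by (simp add: block_seqs_def)
    then have "unblock (\<lambda>i. \<omega> (Suc i)) \<in> B \<longleftrightarrow> unblock \<omega> \<in> B"
      unfolding unblock_shift using shift unblock_in_markov_shift by simp
    then show "(\<lambda>i. \<omega> (Suc i)) \<in> {\<omega> \<in> space (PiM UNIV (\<lambda>_. block_measure)). unblock \<omega> \<in> B} \<longleftrightarrow>
        \<omega> \<in> {\<omega> \<in> space (PiM UNIV (\<lambda>_. block_measure)). unblock \<omega> \<in> B}"
      using \<omega> by (auto simp: block_seqs_def[symmetric] space_block_seqs)
  qed (use C in \<open>simp add: block_seqs_def\<close>)
  moreover have "phase_prob k B = measure block_seqs ?C" for k
    unfolding phase_prob_def using shift unblock_in_markov_shift
    by (intro arg_cong[of _ _ "measure block_seqs"]) auto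
  ultimately show "measure phased B = 0 \<or> measure phased B = 1"
    using n_pos by (simp add: measure_phased[OF B])
qed

definition "letters = (\<Union>w\<in>W. set w)"

lemma finite_letters: "finite letters"
  unfolding letters_def using finite_W by auto

lemma block_names_inj:
  assumes "v \<in> W" "w \<in> W" "\<And>m. m < n \<Longrightarrow> collapse letters (v ! m) = collapse letters (w ! m)"
  shows "v = w"
proof (rule nth_equalityI)
  show "length v = length w" using assms length_W by simp
  fix m assume m: "m < length v"
  then have "v ! m \<in> letters" using assms(1) unfolding letters_def by (auto intro: nth_mem)
  then show "v ! m = w ! m"
    using assms(3)[of m] m length_W[OF assms(1)] by (auto simp: collapse_def split: if_splits)
qed

text \<open>Read from phase \<open>k\<close>, a window of length \<open>q * n\<close> may cut block
  0 but contains the blocks \<open>1\<close> to \<open>q - 1\<close> completely. The name prescribes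
  each of these independent uniform blocks, whence the exponent \<open>q - 1\<close>.\<close>

lemma phase_prob_name_le:
  assumes k: "k < n"
  shows "phase_prob k {x \<in> markov_shift S. itinerary left_shift (symbol_name letters) (q * n) x = v}
    \<le> (1 / real (card W)) ^ (q - 1)"
proof -
  interpret U: prob_space block_measure by (rule prob_block_measure)
  interpret P: product_prob_space "\<lambda>_::nat. block_measure" UNIV by unfold_locales
  \<comment> \<open>The blocks compatible with the part of the name that block \<open>j\<close>
    occupies; all letters of blocks are visible, so at most one block qualifies.\<close>
  define E where "E j = {w \<in> W. \<forall>m<n. collapse letters (w ! m) = v ! (j * n + m - k)}" for j
  have E_card: "card (E j) \<le> 1" for j
  proof -
    have "finite (E j)" using finite_W by (simp add: E_def)
    moreover have "v = w" if "v \<in> E j" "w \<in> E j" for v w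
      using that by (intro block_names_inj) (auto simp: E_def)
    ultimately show ?thesis unfolding One_nat_def by (subst card_le_Suc0_iff_eq) blast+
  qed
  have E_sets: "E j \<in> sets block_measure" for j by (auto simp: E_def)
  have E_meas: "measure block_measure (E j) \<le> 1 / real (card W)" for j
  proof -
    have "measure block_measure (E j) = real (card (E j)) / real (card W)"
      unfolding block_measure_def by (rule measure_uniform_count_measure) (auto simp: E_def finite_W)
    then show ?thesis using E_card[of j] by (simp add: divide_right_mono)
  qed
  let ?Z = "{\<omega> \<in> space block_seqs. \<forall>j\<in>{1..<q}. \<omega> j \<in> E j}"
  have "emeasure block_seqs ?Z = (\<Prod>j\<in>{1..<q}. emeasure block_measure (E j))"
    unfolding block_seqs_def by (rule P.emeasure_PiM_Collect) (use E_sets in auto)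
  then have Z: "measure block_seqs ?Z = (\<Prod>j\<in>{1..<q}. measure block_measure (E j))"
    unfolding U.emeasure_eq_measure
    by (intro measure_eq_emeasure_eq_ennreal prod_nonneg) (simp_all add: prod_ennreal)
  have Zm: "?Z \<in> sets block_seqs"
  proof (rule sets.sets_Collect_finite_All)
    fix j
    have "(\<lambda>\<omega>. \<omega> j) \<in> measurable block_seqs block_measure"
      unfolding block_seqs_def by (rule measurable_component_singleton) simp
    from measurable_sets[OF this E_sets[of j]]
    show "{\<omega> \<in> space block_seqs. \<omega> j \<in> E j} \<in> sets block_seqs"
      by (simp add: vimage_def Int_def conj_commute)
  qed simp
  have "{\<omega> \<in> space block_seqs. (left_shift ^^ k) (unblock \<omega>) \<in>
      {x \<in> markov_shift S. itinerary left_shift (symbol_name letters) (q * n) x = v}} \<subseteq> ?Z"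
  proof (intro subsetI CollectI conjI ballI)
    fix \<omega> j
    assume "\<omega> \<in> {\<omega> \<in> space block_seqs. (left_shift ^^ k) (unblock \<omega>) \<in>
      {x \<in> markov_shift S. itinerary left_shift (symbol_name letters) (q * n) x = v}}"
    then have \<omega>: "\<omega> \<in> space block_seqs"
      and v: "v = map (collapse letters) (map ((left_shift ^^ k) (unblock \<omega>)) [0..<q * n])"
      by (auto simp: itinerary_symbol_name)
    then show "\<omega> \<in> space block_seqs" by simp
    assume j: "j \<in> {1..<q}"
    have "collapse letters (\<omega> j ! m) = v ! (j * n + m - k)" if m: "m < n" for m
    proof -
      \<comment> \<open>From \<open>j \<ge> 1\<close> and \<open>k < n\<close> the natural-number
        difference is exact; \<open>j < q\<close> keeps the index inside the window.\<close>
      have "n \<le> j * n" using j by simp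
      moreover have "Suc j * n \<le> q * n" using j by (intro mult_right_mono) auto
      moreover have "k + (J + m - k) = J + m" "J + m - k < Q" if "n \<le> J" "n + J \<le> Q" for J Q
        using that k m by linarith+
      ultimately have i: "k + (j * n + m - k) = j * n + m" "j * n + m - k < q * n"
        by simp_all
      have "v ! (j * n + m - k) = collapse letters (unblock \<omega> (j * n + m))"
        using i by (simp add: v funpow_left_shift)
      also have "unblock \<omega> (j * n + m) = \<omega> j ! m" using m by (simp add: unblock_def)
      finally show ?thesis by simp
    qed
    then show "\<omega> j \<in> E j" using \<omega> by (simp add: E_def space_block_seqs)
  qed
  then have "phase_prob k {x \<in> markov_shift S. itinerary left_shift (symbol_name letters) (q * n) x = v}
      \<le> measure block_seqs ?Z"
    unfolding phase_prob_def
    using prob_space.finite_measure[OF prob_block_seqs] Zm by (intro finite_measure.finite_measure_mono)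
  also have "\<dots> \<le> (\<Prod>j\<in>{1..<q}. 1 / real (card W))"
    unfolding Z by (rule prod_mono) (use E_meas in auto)
  finally show ?thesis by simp
qed

text \<open>Every name of length \<open>(p + 1) * n\<close> has probability at most
  \<open>(1 / card W) ^ p\<close>, so its entropy is at least \<open>p * ln (card W)\<close>. The
  one lost block is irrelevant as \<open>p\<close> grows.\<close>

lemma ks_entropy_phased_ge: "ereal (ln (real (card W)) / real n) \<le> ks_entropy phased left_shift"
proof -
  interpret markov_measure S phased by unfold_locales (rule phased_invariant)
  let ?X = "symbol_name letters"
  let ?N = "real (card W)"
  have N: "0 < ?N" using finite_W W_nonempty by (simp add: card_gt_0_iff)
  have X: "simple_function phased ?X" by (rule simple_function_symbol_name[OF finite_letters])
  have H: "real p * ln ?N \<le> obs_entropy phased (itinerary left_shift ?X (Suc p * n))" for p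
  proof (rule obs_entropy_ge_of_max_prob[OF simple_function_itinerary[OF X]])
    fix v
    let ?B = "{x \<in> markov_shift S. itinerary left_shift ?X (Suc p * n) x = v}"
    have B_eq: "itinerary left_shift ?X (Suc p * n) -` {v} \<inter> space phased = ?B" by auto
    have B: "?B \<in> sets (shift_borel S)"
      using simple_functionD(2)[OF simple_function_itinerary[OF X], of "Suc p * n" "{v}"]
      unfolding B_eq by simp
    have "(\<Sum>k<n. phase_prob k ?B) \<le> real (card {..<n}) * (1 / ?N) ^ (Suc p - 1)"
      by (rule sum_bounded_above) (use phase_prob_name_le[of _ "Suc p" v] in auto)
    then have "measure phased ?B \<le> (1 / ?N) ^ p"
      unfolding measure_phased[OF B] using n_pos by (simp add: divide_le_eq mult.commute)
    also have "(1 / ?N) ^ p = exp (- (real p * ln ?N))"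
      using N by (simp add: exp_minus exp_of_nat_mult power_one_over inverse_eq_divide)
    finally show "obs_prob phased (itinerary left_shift ?X (Suc p * n)) v \<le> exp (- (real p * ln ?N))"
      unfolding obs_prob_def B_eq .
  qed
  have "ln ?N / real n * (1 - 0) \<le> entropy_rate phased left_shift ?X"
  proof (rule LIMSEQ_le)
    show "(\<lambda>p. ln ?N / real n * (1 - inverse (real (Suc p)))) \<longlonglongrightarrow> ln ?N / real n * (1 - 0)"
      by (intro tendsto_intros LIMSEQ_inverse_real_of_nat)
    have "strict_mono (\<lambda>p. Suc p * n)" using n_pos by (auto simp: strict_mono_Suc_iff)
    from LIMSEQ_subseq_LIMSEQ[OF entropy_rate_lim[OF X] this]
    show "(\<lambda>p. obs_entropy phased (itinerary left_shift ?X (Suc p * n)) / real (Suc p * n))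
        \<longlonglongrightarrow> entropy_rate phased left_shift ?X"
      by (simp add: comp_def)
    have "ln ?N / real n * (1 - inverse (real (Suc p))) \<le>
        obs_entropy phased (itinerary left_shift ?X (Suc p * n)) / real (Suc p * n)" for p
    proof -
      have "ln ?N / real n * (1 - inverse (real (Suc p))) = real p * ln ?N / real (Suc p * n)"
        using n_pos by (simp add: field_simps)
      also have "\<dots> \<le> obs_entropy phased (itinerary left_shift ?X (Suc p * n)) / real (Suc p * n)"
        by (rule divide_right_mono[OF H]) simp
      finally show ?thesis .
    qed
    then show "\<exists>N. \<forall>p\<ge>N. ln ?N / real n * (1 - inverse (real (Suc p))) \<le>
        obs_entropy phased (itinerary left_shift ?X (Suc p * n)) / real (Suc p * n)" by blast
  qed
  then have "ereal (ln ?N / real n) \<le> ereal (entropy_rate phased left_shift ?X)" by simp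
  also have "\<dots> \<le> ks_entropy phased left_shift" by (rule entropy_rate_le_ks_entropy[OF X])
  finally show ?thesis .
qed

end

section \<open>Growth of loops and of bridges between two symbols\<close>

lemma successively_glue:
  "successively S (p @ [b]) \<Longrightarrow> successively S (b # q) \<Longrightarrow> successively S (p @ b # q)"
  by (auto simp: successively_append_iff)

text \<open>Any finite set of loops of one length at \<open>a\<close> is a block code, whose ergodic
  measure has entropy at most the topological entropy. The resulting rate is the same for every
  \<open>a\<close>.\<close>

lemma loops_exponential_bound:
  fixes S :: "'a::countable \<Rightarrow> 'a \<Rightarrow> bool"
  assumes "topological_entropy S < \<infinity>"
  obtains c where "0 \<le> c"
    "\<And>a l. finite (bridges S a a l) \<and> real (card (bridges S a a l)) \<le> exp (c * (real l + 1))"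
proof
  \<comment> \<open>The maximum with 0 also covers a shift without ergodic measures, where the
    supremum is minus infinity.\<close>
  let ?c = "max 0 (real_of_ereal (topological_entropy S))"
  show "0 \<le> ?c" by simp
  fix a l
  have sub: "real (card V) \<le> exp (?c * (real l + 1))" if V: "V \<subseteq> bridges S a a l" "finite V" for V
  proof (cases "V = {}")
    case False
    \<comment> \<open>Each loop is written from its start at \<open>a\<close> up to just before its
      return, so the blocks have length \<open>l + 1\<close> and any two can follow each
      other.\<close>
    let ?W = "(\<lambda>m. a # m) ` V"
    interpret block_code S ?W "Suc l"
    proof
      fix v w assume "v \<in> ?W" "w \<in> ?W"
      then obtain m m' where m: "v = a # m" "w = a # m'" "successively S ((a # m) @ [a])"
          "successively S ((a # m') @ [a])"
        using V(1) unfolding bridges_def by auto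
      from m(4) have "successively S (a # m')" by (simp only: successively_append_iff)
      then show "successively S (v @ w)" unfolding m(1,2) by (rule successively_glue[OF m(3)])
    qed (use V False in \<open>auto simp: bridges_def\<close>)
    have card: "card ?W = card V" by (rule card_image) auto
    have "ereal (ln (real (card V)) / real (Suc l)) \<le> ks_entropy phased left_shift"
      using ks_entropy_phased_ge card by simp
    also have "\<dots> \<le> topological_entropy S"
      unfolding topological_entropy_def by (rule SUP_upper[OF phased_ergodic])
    finally have "ln (real (card V)) / real (Suc l) \<le> ?c"
      using assms by (cases "topological_entropy S") auto
    then have "ln (real (card V)) \<le> ?c * (real l + 1)" by (simp add: divide_le_eq add.commute)
    moreover have "0 < real (card V)" using False V(2) by (simp add: card_gt_0_iff)
    ultimately show ?thesis by (metis exp_le_cancel_iff exp_ln)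
  qed simp
  \<comment> \<open>The bound for all finite subsets is uniform, which forces the whole set to be
    finite.\<close>
  have "finite (bridges S a a l) \<and> card (bridges S a a l) \<le> nat \<lfloor>exp (?c * (real l + 1))\<rfloor>"
    by (rule finite_if_finite_subsets_card_bdd) (use sub in \<open>simp add: le_nat_floor\<close>)
  then show "finite (bridges S a a l) \<and> real (card (bridges S a a l)) \<le> exp (?c * (real l + 1))"
    using sub by blast
qed

text \<open>A fixed return path from \<open>b\<close> to \<open>a\<close> closes every bridge to a
  loop at \<open>a\<close>, injectively. It lengthens all bridges by the same amount, so only the
  constant depends on \<open>a\<close> and \<open>b\<close>, not the rate.\<close>

lemma bridges_exponential_bound:
  fixes S :: "'a::countable \<Rightarrow> 'a \<Rightarrow> bool"
  assumes "transitive_shift S" "0 \<le> c"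
    and loops: "\<And>a l. finite (bridges S a a l) \<and> real (card (bridges S a a l)) \<le> exp (c * (real l + 1))"
  shows "\<exists>\<beta>\<ge>0. \<forall>l. finite (bridges S a b l) \<and> real (card (bridges S a b l)) \<le> exp (\<beta> + c * real l)"
proof (cases "a = b")
  case True
  then show ?thesis
    using loops[of a] \<open>0 \<le> c\<close> by (intro exI[of _ c]) (simp add: algebra_simps)
next
  case False
  obtain w where w: "w \<noteq> []" "successively S w" "hd w = b" "last w = a"
    using assms(1) unfolding transitive_shift_def by blast
  then obtain u where u: "w = b # u" by (cases w) auto
  then have "u \<noteq> []" "last u = a" using w False by auto
  then obtain v where "u = v @ [a]" by (metis append_butlast_last_id)
  with w u have v: "successively S (b # v @ [a])" by simp
  \<comment> \<open>The return path adds the letter \<open>b\<close> and the word \<open>v\<close>;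
    the final \<open>a\<close> is the end point of the loop and is not counted.\<close>
  let ?d = "Suc (length v)"
  have le: "finite (bridges S a b l) \<and> real (card (bridges S a b l)) \<le> exp (c * (1 + real ?d) + c * real l)" for l
  proof -
    let ?f = "\<lambda>m. m @ b # v"
    have inj: "inj_on ?f (bridges S a b l)" by (auto simp: inj_on_def)
    have sub: "?f ` bridges S a b l \<subseteq> bridges S a a (l + ?d)"
    proof
      fix z assume "z \<in> ?f ` bridges S a b l"
      then obtain m where m: "length m = l" "successively S (a # m @ [b])" "z = m @ b # v"
        by (auto simp: bridges_def)
      have "successively S ((a # m) @ b # v @ [a])"
        by (rule successively_glue[OF _ v]) (use m(2) in simp)
      then show "z \<in> bridges S a a (l + ?d)" using m by (simp add: bridges_def)
    qed
    have fin: "finite (bridges S a b l)"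
      using finite_subset[OF sub] loops finite_image_iff[OF inj] by blast
    have "card (bridges S a b l) \<le> card (bridges S a a (l + ?d))"
      using card_image[OF inj] card_mono[OF _ sub] loops by metis
    then have "real (card (bridges S a b l)) \<le> exp (c * (real (l + ?d) + 1))"
      using loops[of a "l + ?d"] by linarith
    also have "c * (real (l + ?d) + 1) = c * (1 + real ?d) + c * real l" by (simp add: algebra_simps)
    finally show ?thesis using fin by simp
  qed
  show ?thesis using le \<open>0 \<le> c\<close> by (intro exI[of _ "c * (1 + real ?d)"]) simp
qed

lemma bridge_bound_exists:
  fixes S :: "'a::countable \<Rightarrow> 'a \<Rightarrow> bool"
  assumes "transitive_shift S" "0 \<le> c" "finite F"
    and loops: "\<And>a l. finite (bridges S a a l) \<and> real (card (bridges S a a l)) \<le> exp (c * (real l + 1))"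
  obtains F' \<beta> L where "finite F'" "\<And>G. finite G \<Longrightarrow> F' \<subseteq> G \<Longrightarrow> bridge_bound S F F' G c \<beta> L"
proof -
  obtain b0 where b0: "\<And>a b. 0 \<le> b0 a b" "\<And>a b l. finite (bridges S a b l)"
      "\<And>a b l. real (card (bridges S a b l)) \<le> exp (b0 a b + c * real l)"
    using bridges_exponential_bound[OF assms(1,2) loops] by metis
  \<comment> \<open>A sum over the finitely many pairs, which dominates each nonnegative
    term.\<close>
  define \<beta> where "\<beta> = (\<Sum>(a, b)\<in>F \<times> F. b0 a b)"
  have \<beta>: "b0 a b \<le> \<beta>" if "a \<in> F" "b \<in> F" for a b
    unfolding \<beta>_def using member_le_sum[of "(a, b)" "F \<times> F" "\<lambda>(a, b). b0 a b"] that b0(1) \<open>finite F\<close>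
    by auto
  define L where "L = nat \<lceil>\<beta>\<rceil>"
  \<comment> \<open>Finite because each pair of end points in \<open>F\<close> has finitely many
    bridges of each length up to \<open>L\<close>. Neither \<open>F'\<close> nor
    \<open>\<beta>\<close> nor \<open>L\<close> depends on \<open>G\<close>.\<close>
  define F' where "F' = F \<union> (\<Union>a\<in>F. \<Union>b\<in>F. \<Union>l\<in>{..L}. \<Union>m\<in>bridges S a b l. set m)"
  show ?thesis
  proof
    show "finite F'" unfolding F'_def using \<open>finite F\<close> b0(2) by auto
    fix G assume G: "finite G" "F' \<subseteq> G"
    show "bridge_bound S F F' G c \<beta> L"
    proof
      show "\<beta> \<le> real L" unfolding L_def by linarith
      fix a b l assume ab: "a \<in> F" "b \<in> F"
      show "real (card (bridges S a b l)) \<le> exp (\<beta> + c * real l)"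
        using b0(3)[of a b l] \<beta>[OF ab] by (meson add_right_mono exp_le_cancel_iff order_trans)
      show "set m \<subseteq> F'" if "l \<le> L" "m \<in> bridges S a b l" for m
        using ab that unfolding F'_def by blast
    qed (use G assms b0 in \<open>auto simp: F'_def\<close>)
  qed
qed

section \<open>Upper semicontinuity of the entropy\<close>

text \<open>If no variation were below \<open>e\<close>, the partial sums of the series would be
  unbounded; one small variation controls \<open>\<phi>\<close> on a cylinder around each
  point.\<close>

lemma summable_variations_continuous:
  assumes "summable_variations S \<phi>"
  shows "continuous_map (shift_topology S) euclideanreal \<phi>"
proof (rule continuous_map_shift_topologyI)
  fix x e assume x: "x \<in> markov_shift S" and e: "0 < (e :: real)"
  let ?v = "variation S \<phi>"
  have v_nonneg: "0 \<le> ?v n" for n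
    unfolding variation_def using x by (intro SUP_upper2[of "(x, x)"]) auto
  have "\<exists>n. ?v (Suc n) < ereal e"
  proof (rule ccontr)
    assume "\<not> ?thesis"
    then have ge: "ereal e \<le> ?v (Suc n)" for n by (simp add: not_less)
    have "ereal (real N * e) \<le> (\<Sum>n. ?v (Suc n))" for N
    proof -
      have "ereal (real N * e) = (\<Sum>n<N. ereal e)" by simp
      also have "\<dots> \<le> (\<Sum>n<N. ?v (Suc n))" by (rule sum_mono) (rule ge)
      also have "\<dots> \<le> (\<Sum>n. ?v (Suc n))" by (rule suminf_upper) (rule v_nonneg)
      finally show ?thesis .
    qed
    moreover obtain r where "(\<Sum>n. ?v (Suc n)) = ereal r"
      using assms suminf_0_le[of "\<lambda>n. ?v (Suc n)"] v_nonneg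
      unfolding summable_variations_def by (cases "\<Sum>n. ?v (Suc n)") auto
    ultimately have "real N * e \<le> r" for N by simp
    moreover obtain N where "r < real N * e" using reals_Archimedean3[OF e] by blast
    ultimately show False by (meson not_less)
  qed
  then obtain n where n: "?v (Suc n) < ereal e" ..
  have "\<phi> y - \<phi> z < e" if "y \<in> markov_shift S" "z \<in> markov_shift S" "\<forall>i<Suc n. y i = z i" for y z
  proof -
    have "ereal (\<phi> y - \<phi> z) \<le> ?v (Suc n)"
      unfolding variation_def using that by (intro SUP_upper2[of "(y, z)"]) auto
    then show ?thesis using n by (metis ereal_less_eq(3) less_ereal.simps(1) not_less order_le_less_trans)
  qed
  from this[of _ x] this[of x] show "\<exists>n. \<forall>y\<in>markov_shift S. (\<forall>i<n. y i = x i) \<longrightarrow> \<bar>\<phi> y - \<phi> x\<bar> < e"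
    using x by (intro exI[of _ "Suc n"]) (auto simp: abs_less_iff)
qed

text \<open>A set determined by finitely many coordinates is clopen, so its indicator is itself a
  bounded continuous test function.\<close>

lemma weak_star_measure_tendsto:
  fixes S :: "'a::countable \<Rightarrow> 'a \<Rightarrow> bool"
  assumes ws: "weak_star_converges S \<mu>s \<mu>"
    and inv: "\<And>n. \<mu>s n \<in> invariant_measures S" "\<mu> \<in> invariant_measures S"
    and A: "A \<in> sets (shift_borel S)"
    and det: "\<And>x y. x \<in> markov_shift S \<Longrightarrow> y \<in> markov_shift S \<Longrightarrow> (\<forall>i<k. x i = y i) \<Longrightarrow> x \<in> A \<longleftrightarrow> y \<in> A"
  shows "(\<lambda>n. measure (\<mu>s n) A) \<longlonglongrightarrow> measure \<mu> A"
proof -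
  have "continuous_map (shift_topology S) euclideanreal (indicator A)"
  proof (rule continuous_map_shift_topologyI)
    fix x and e :: real assume "x \<in> markov_shift S" "0 < e"
    show "\<exists>n. \<forall>y\<in>markov_shift S. (\<forall>i<n. y i = x i) \<longrightarrow> \<bar>indicator A y - indicator A x\<bar> < e"
    proof (intro exI[of _ k] ballI impI)
      fix y assume "y \<in> markov_shift S" "\<forall>i<k. y i = x i"
      then have "y \<in> A \<longleftrightarrow> x \<in> A" using det \<open>x \<in> markov_shift S\<close> by blast
      then have "indicator A y = (indicator A x :: real)" by (simp only: indicator_def)
      then show "\<bar>indicator A y - indicator A x\<bar> < e" using \<open>0 < e\<close> by simp
    qed
  qed
  moreover have "bounded (indicat_real A ` markov_shift S)"
    by (rule boundedI[of _ 1]) (auto simp: indicator_def)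
  ultimately have lim: "(\<lambda>n. \<integral>x. indicator A x \<partial>\<mu>s n) \<longlonglongrightarrow> (\<integral>x. indicat_real A x \<partial>\<mu>)"
    using ws unfolding weak_star_converges_def by blast
  have int: "(\<integral>x. indicat_real A x \<partial>M) = measure M A" if "M \<in> invariant_measures S" for M
  proof -
    have "A \<in> sets M" using that A by (simp add: invariant_measures_def)
    then show ?thesis using sets.sets_into_space[of A M] by (simp add: Int_absorb1)
  qed
  show ?thesis using lim by (simp only: int inv)
qed

text \<open>The logarithm is not continuous at 0, so a vanishing limit is treated by the square root
  bound.\<close>

lemma tendsto_xlnx:
  fixes p :: "nat \<Rightarrow> real"
  assumes p: "p \<longlonglongrightarrow> q" and "\<And>n. 0 \<le> p n" "\<And>n. p n \<le> 1"
  shows "(\<lambda>n. p n * ln (p n)) \<longlonglongrightarrow> q * ln q"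
proof (cases "q = 0")
  case True
  have "(\<lambda>n. p n * ln (p n)) \<longlonglongrightarrow> 0"
  proof (rule Lim_null_comparison)
    show "\<forall>\<^sub>F n in sequentially. norm (p n * ln (p n)) \<le> 2 * sqrt (p n)"
    proof (rule always_eventually, rule allI)
      fix n
      have "p n * ln (p n) \<le> 0"
      proof (cases "p n = 0")
        case False
        then have "0 < p n" using assms(2)[of n] by simp
        then have "ln (p n) \<le> 0" using assms(3)[of n] by simp
        then show ?thesis using assms(2)[of n] by (rule mult_nonneg_nonpos[rotated])
      qed simp
      then show "norm (p n * ln (p n)) \<le> 2 * sqrt (p n)"
        using neg_xlnx_le_sqrt[OF assms(2)[of n]] by simp
    qed
    have "(\<lambda>n. 2 * sqrt (p n)) \<longlonglongrightarrow> 2 * sqrt q" by (intro tendsto_intros p)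
    then show "(\<lambda>n. 2 * sqrt (p n)) \<longlonglongrightarrow> 0" using True by simp
  qed
  then show ?thesis using True by simp
next
  case False
  then show ?thesis by (intro tendsto_intros p)
qed

text \<open>For finite \<open>F\<close> and fixed \<open>k\<close> there are finitely many possible
  names, each a clopen event.\<close>

lemma obs_entropy_names_tendsto:
  fixes S :: "'a::countable \<Rightarrow> 'a \<Rightarrow> bool"
  assumes ws: "weak_star_converges S \<mu>s \<mu>"
    and inv: "\<And>n. \<mu>s n \<in> invariant_measures S" "\<mu> \<in> invariant_measures S"
    and F: "finite F"
  shows "(\<lambda>n. obs_entropy (\<mu>s n) (itinerary left_shift (symbol_name F) k))
    \<longlonglongrightarrow> obs_entropy \<mu> (itinerary left_shift (symbol_name F) k)"
proof -
  let ?I = "itinerary left_shift (symbol_name F) k"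
  let ?V = "{z. set z \<subseteq> insert None (Some ` F) \<and> length z = k}"
  have fin: "finite ?V" using F by (intro finite_lists_length_eq) simp
  have eq: "obs_entropy M ?I = - (\<Sum>v\<in>?V. obs_prob M ?I v * ln (obs_prob M ?I v))" for M
  proof (rule obs_entropy_superset[OF fin])
    show "?I ` space M \<subseteq> ?V"
      using collapse_in[of F] by (fastforce simp: itinerary_symbol_name)
  qed
  have lim: "(\<lambda>n. obs_prob (\<mu>s n) ?I v) \<longlonglongrightarrow> obs_prob \<mu> ?I v" for v
  proof -
    let ?A = "?I -` {v} \<inter> markov_shift S"
    have prob: "obs_prob M ?I v = measure M ?A" and A: "?A \<in> sets (shift_borel S)"
      if "M \<in> invariant_measures S" for M
    proof -
      interpret markov_measure S M by unfold_locales (rule that)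
      show "obs_prob M ?I v = measure M ?A" by (simp add: obs_prob_def space_eq)
      show "?A \<in> sets (shift_borel S)"
        using simple_functionD(2)[OF simple_function_itinerary[OF simple_function_symbol_name[OF F]], of k "{v}"]
        unfolding space_eq sets_eq .
    qed
    have "(\<lambda>n. measure (\<mu>s n) ?A) \<longlonglongrightarrow> measure \<mu> ?A"
    proof (rule weak_star_measure_tendsto[OF ws inv A[OF inv(2)]])
      fix x y assume "x \<in> markov_shift S" "y \<in> markov_shift S" "\<forall>i<k. x i = y i"
      moreover from this have "?I x = ?I y"
        by (simp add: itinerary_eq_iff symbol_name_def funpow_left_shift)
      ultimately show "x \<in> ?A \<longleftrightarrow> y \<in> ?A" by simp
    qed
    then show ?thesis by (simp only: prob inv)
  qed
  have le1: "obs_prob (\<mu>s n) ?I v \<le> 1" for n v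
  proof -
    interpret markov_measure S "\<mu>s n" by unfold_locales (rule inv)
    show ?thesis by (rule obs_prob_le_1)
  qed
  show ?thesis unfolding eq by (intro tendsto_intros tendsto_xlnx lim le1 obs_prob_nonneg)
qed

text \<open>The initial segments of an enumeration of the alphabet have complements decreasing to
  the empty set.\<close>

lemma (in markov_measure) small_complement_of_finite_alphabet:
  assumes "0 < e"
  shows "\<exists>F. finite F \<and> measure M {x \<in> space M. x 0 \<notin> F} < e"
proof -
  let ?F = "\<lambda>k. {a :: 'a. to_nat a < k}"
  let ?B = "\<lambda>k. {x \<in> space M. x 0 \<notin> ?F k}"
  have "?B k \<in> sets M" for k using symbol_set_in_sets[of 0 "- ?F k"] by simp
  then have "(\<lambda>k. measure M (?B k)) \<longlonglongrightarrow> measure M (\<Inter>k. ?B k)"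
    by (intro finite_Lim_measure_decseq) (auto simp: decseq_def)
  moreover have "(\<Inter>k. ?B k) = {}" by auto
  ultimately have "\<forall>\<^sub>F k in sequentially. measure M (?B k) < e"
    using assms by (intro order_tendstoD(2)) auto
  then obtain k where "measure M (?B k) < e" using eventually_happens sequentially_bot by blast
  moreover have "finite (?F k)" using finite_vimageI[of "{..<k}" "to_nat :: 'a \<Rightarrow> nat"] by (simp add: vimage_def)
  ultimately show ?thesis by blast
qed

theorem ks_entropy_upper_semicontinuous:
  fixes S :: "'a::countable \<Rightarrow> 'a \<Rightarrow> bool"
  assumes "transitive_shift S" "topological_entropy S < \<infinity>"
    and erg: "\<And>n. \<mu>s n \<in> ergodic_measures S" and "\<mu> \<in> invariant_measures S"
    and ws: "weak_star_converges S \<mu>s \<mu>" and "0 < e"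
  shows "\<forall>\<^sub>F n in sequentially. ks_entropy (\<mu>s n) left_shift \<le> ks_entropy \<mu> left_shift + ereal e"
proof -
  interpret \<mu>: markov_measure S \<mu> by unfold_locales (rule assms(4))
  have inv: "\<mu>s n \<in> invariant_measures S" for n using erg[of n] by (simp add: ergodic_measures_def)
  obtain c where c: "0 \<le> c"
      "\<And>a l. finite (bridges S a a l) \<and> real (card (bridges S a a l)) \<le> exp (c * (real l + 1))"
    using loops_exponential_bound[OF assms(2)] by blast
  \<comment> \<open>The second entry limits the hidden entropy \<open>(c + 1) * \<delta>\<close> to
    \<open>e / 4\<close>. The bound \<open>1 / 2\<close> guarantees that the measures in the
    sequence eventually give \<open>F\<close> positive mass.\<close>
  define \<delta> where "\<delta> = min (1 / 2) (e / 4 / (c + 1))"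
  have \<delta>: "0 < \<delta>" "\<delta> \<le> 1 / 2"
    unfolding \<delta>_def using \<open>0 < e\<close> c(1) by (simp, linarith)
  have "\<delta> \<le> e / 4 / (c + 1)" unfolding \<delta>_def by (rule min.cobounded2)
  then have c\<delta>: "(c + 1) * \<delta> \<le> e / 4"
    using c(1) by (subst (asm) pos_le_divide_eq) (auto simp: mult.commute)
  obtain F where F: "finite F" "measure \<mu> {x \<in> space \<mu>. x 0 \<notin> F} < \<delta>"
    using \<mu>.small_complement_of_finite_alphabet[OF \<delta>(1)] by blast
  obtain F' \<beta> L where F': "finite F'"
      and bb: "\<And>G. finite G \<Longrightarrow> F' \<subseteq> G \<Longrightarrow> bridge_bound S F F' G c \<beta> L"
    using bridge_bound_exists[OF assms(1) c(1) F(1) c(2)] by blast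
  let ?Y = "symbol_name F'"
  let ?r = "entropy_rate \<mu> left_shift ?Y"
  let ?q = "\<lambda>M. measure M {x \<in> markov_shift S. x 0 \<notin> F}"
  have sY: "simple_function \<mu> ?Y" by (rule \<mu>.simple_function_symbol_name[OF F'])
  \<comment> \<open>A time \<open>k\<close> is frozen at which the coarse entropy of the limit is
    nearly attained. At fixed \<open>k\<close> this quantity is weak* continuous, and for the other
    measures it bounds the coarse rate from above.\<close>
  have "\<forall>\<^sub>F k in sequentially. obs_entropy \<mu> (itinerary left_shift ?Y k) / real k < ?r + e / 4"
    using \<open>0 < e\<close> by (intro order_tendstoD(2)[OF \<mu>.entropy_rate_lim[OF sY]]) simp
  then have "\<forall>\<^sub>F k in sequentially. 1 \<le> k \<and> obs_entropy \<mu> (itinerary left_shift ?Y k) / real k < ?r + e / 4"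
    using eventually_ge_at_top[of 1] by (rule eventually_conj[rotated])
  then obtain k where k: "1 \<le> k" "obs_entropy \<mu> (itinerary left_shift ?Y k) / real k < ?r + e / 4"
    using eventually_happens sequentially_bot by blast
  have "(\<lambda>n. obs_entropy (\<mu>s n) (itinerary left_shift ?Y k) / real k)
      \<longlonglongrightarrow> obs_entropy \<mu> (itinerary left_shift ?Y k) / real k"
    using k(1) by (intro tendsto_divide tendsto_const obs_entropy_names_tendsto[OF ws inv assms(4) F']) auto
  then have ev1: "\<forall>\<^sub>F n in sequentially.
      obs_entropy (\<mu>s n) (itinerary left_shift ?Y k) / real k < ?r + e / 4"
    using k(2) by (rule order_tendstoD(2))
  have "{x \<in> markov_shift S. x 0 \<notin> F} \<in> sets (shift_borel S)"
    using \<mu>.symbol_set_in_sets[of 0 "- F"] by (simp add: \<mu>.space_eq \<mu>.sets_eq)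
  then have "(\<lambda>n. ?q (\<mu>s n)) \<longlonglongrightarrow> ?q \<mu>"
    by (rule weak_star_measure_tendsto[OF ws inv assms(4), where k = 1]) auto
  then have ev2: "\<forall>\<^sub>F n in sequentially. ?q (\<mu>s n) < \<delta>"
    using F(2) unfolding \<mu>.space_eq by (rule order_tendstoD(2))
  from ev1 ev2 show ?thesis
  proof eventually_elim
    case (elim n)
    let ?B = "?r + e / 4 + e / 4"
    interpret M: ergodic_markov_measure S "\<mu>s n" by unfold_locales (rule inv erg)+
    \<comment> \<open>The complement has mass below \<open>\<delta>\<close>, so \<open>F\<close> is
      visited with positive probability, as the excursion estimate requires.\<close>
    have compl: "measure (\<mu>s n) {x \<in> space (\<mu>s n). x 0 \<in> F} = 1 - ?q (\<mu>s n)"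
      using M.prob_compl[OF M.symbol_set_in_sets[of 0 "- F"]]
      by (simp add: M.space_eq set_diff_eq conj_commute cong: conj_cong)
    have "ks_entropy (\<mu>s n) left_shift \<le> ereal ?B"
    proof (rule M.ks_entropy_le_of_symbol_names[OF F'])
      fix G assume G: "finite G" "F' \<subseteq> G"
      interpret bridge_bound S F F' G c \<beta> L by (rule bb[OF G])
      interpret ergodic_bridge_bound S "\<mu>s n" F F' G c \<beta> L
        by unfold_locales (use compl elim(2) \<delta>(2) in linarith)
      have "entropy_rate (\<mu>s n) left_shift (symbol_name G) \<le>
          entropy_rate (\<mu>s n) left_shift ?Y + (c + 1) * ?q (\<mu>s n)"
        using entropy_rate_fine_le_coarse unfolding M.space_eq .
      also have "(c + 1) * ?q (\<mu>s n) \<le> (c + 1) * \<delta>"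
        using elim(2) c(1) by (intro mult_left_mono) auto
      also have "entropy_rate (\<mu>s n) left_shift ?Y \<le> obs_entropy (\<mu>s n) (itinerary left_shift ?Y k) / real k"
        by (rule M.entropy_rate_le[OF M.simple_function_symbol_name[OF F'] k(1)])
      finally show "entropy_rate (\<mu>s n) left_shift (symbol_name G) \<le> ?B"
        using elim(1) c\<delta> by linarith
    qed
    also have "ereal ?B \<le> ereal ?r + ereal e" using \<open>0 < e\<close> by simp
    also have "\<dots> \<le> ks_entropy \<mu> left_shift + ereal e"
      by (intro add_right_mono \<mu>.entropy_rate_le_ks_entropy[OF sY])
    finally show ?case .
  qed
qed

theorem proposition4p2:
  fixes S :: "'a::countable \<Rightarrow> 'a \<Rightarrow> bool"
    and \<phi> :: "(nat \<Rightarrow> 'a) \<Rightarrow> real"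
    and \<mu>s :: "nat \<Rightarrow> (nat \<Rightarrow> 'a) measure"
    and \<mu> :: "(nat \<Rightarrow> 'a) measure"
  assumes "transitive_shift S"
    and "topological_entropy S < \<infinity>"
    and "bounded (\<phi> ` markov_shift S)"
    and "summable_variations S \<phi>"
    and "\<And>n. \<mu>s n \<in> ergodic_measures S"
    and "(\<lambda>n. ks_entropy (\<mu>s n) left_shift + ereal (\<integral>x. \<phi> x \<partial>\<mu>s n))
           \<longlonglongrightarrow> gurevich_pressure S \<phi>"
    and "\<mu> \<in> ergodic_measures S"
    and "weak_star_converges S \<mu>s \<mu>"
  shows "gurevich_pressure S \<phi> = ks_entropy \<mu> left_shift + ereal (\<integral>x. \<phi> x \<partial>\<mu>)"
proof (rule antisym)
  have inv: "\<mu> \<in> invariant_measures S" using assms(7) by (simp add: ergodic_measures_def)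
  then show "ks_entropy \<mu> left_shift + ereal (\<integral>x. \<phi> x \<partial>\<mu>) \<le> gurevich_pressure S \<phi>"
    unfolding gurevich_pressure_def by (rule SUP_upper)
  have int: "(\<lambda>n. \<integral>x. \<phi> x \<partial>\<mu>s n) \<longlonglongrightarrow> (\<integral>x. \<phi> x \<partial>\<mu>)"
    using assms(8) summable_variations_continuous[OF assms(4)] assms(3)
    unfolding weak_star_converges_def by blast
  show "gurevich_pressure S \<phi> \<le> ks_entropy \<mu> left_shift + ereal (\<integral>x. \<phi> x \<partial>\<mu>)"
  \<comment> \<open>An error \<open>e / 2\<close> is allowed for the integrals and
    \<open>e / 2\<close> for the entropies.\<close>
  proof (rule ereal_le_epsilon2)
    fix e :: real assume e: "0 < e"
    have "\<forall>\<^sub>F n in sequentially. (\<integral>x. \<phi> x \<partial>\<mu>s n) < (\<integral>x. \<phi> x \<partial>\<mu>) + e / 2"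
      using e by (intro order_tendstoD(2)[OF int]) simp
    moreover have "\<forall>\<^sub>F n in sequentially. ks_entropy (\<mu>s n) left_shift \<le> ks_entropy \<mu> left_shift + ereal (e / 2)"
      
      using e by (intro ks_entropy_upper_semicontinuous[OF assms(1,2,5) inv assms(8)]) simp
    ultimately have "\<forall>\<^sub>F n in sequentially. ks_entropy (\<mu>s n) left_shift + ereal (\<integral>x. \<phi> x \<partial>\<mu>s n)
        \<le> ks_entropy \<mu> left_shift + ereal (\<integral>x. \<phi> x \<partial>\<mu>) + ereal e"
    proof eventually_elim
      case (elim n)
      have "ks_entropy (\<mu>s n) left_shift + ereal (\<integral>x. \<phi> x \<partial>\<mu>s n)
          \<le> (ks_entropy \<mu> left_shift + ereal (e / 2)) + ereal ((\<integral>x. \<phi> x \<partial>\<mu>) + e / 2)"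
        using elim by (intro add_mono) auto
      \<comment> \<open>Entropies are extended reals, so the rearrangement is checked separately for
        finite and infinite values.\<close>
      also have "\<dots> = ks_entropy \<mu> left_shift + ereal (\<integral>x. \<phi> x \<partial>\<mu>) + ereal e"
        by (cases "ks_entropy \<mu> left_shift") auto
      finally show ?case .
    qed
    then show "gurevich_pressure S \<phi> \<le> ks_entropy \<mu> left_shift + ereal (\<integral>x. \<phi> x \<partial>\<mu>) + ereal e"
      by (intro tendsto_upperbound[OF assms(6)]) auto
  qed
qed

end
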